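(* Let $\alpha\in(0,1]$ and let $\mu\in\mathrm{Prob}(\mathbb{T}^d)$ satisfy a mixing Diophantine condition with parameters $\gamma,\tau>0$. Then $\mathcal{Q}$ is strongly mixing with power rate on $C^\alpha(\mathbb{T}^d)$: there are $C<\infty$ and $p>0$ such that $$\left\|\mathcal{Q}^n\varphi-\int\varphi\,dm\right\|_\infty\le C\,\frac{1}{n^p}\,\|\varphi\|_\alpha\qquad\text{for all }\varphi\in C^\alpha(\mathbb{T}^d)\text{ and all }n\ge1.$$ In fact, $p$ can be chosen to be $\frac{\alpha}{\tau}-\iota$ for any $\iota\in(0,\frac{\alpha}{\tau})$, in which case $C$ depends on $\iota$. Moreover, for every $\varphi\in C^\alpha(\mathbb{T}^d)$ and every $\epsilon>0$ there are $c(\epsilon)>0$ and $n(\epsilon)\in\mathbb{N}$, depending (for fixed $d$ and $\alpha$) only on $\epsilon,\|\varphi\|_\alpha,\gamma,\tau$, such that for all $n\ge n(\epsilon)$ and all $\theta\in\mathbb{T}^d$, $$\mu^{\mathbb{N}}\left\{(\omega_i)_{i\ge0}\colon\left|\frac1n\sum_{j=0}^{n}\varphi(\theta+\omega_0+\cdots+\omega_{j-1})-\int\varphi\,dm\right|>\epsilon\right\}<e^{-c(\epsilon)n},$$ where the $j=0$ term of the sum is $\varphi(\theta)$.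
   Context: $\mathbb{T}^d=\mathbb{R}^d/\mathbb{Z}^d$, $m$ is its Haar (Lebesgue) probability measure, $\mathrm{Prob}(\mathbb{T}^d)$ is the set of Borel probability measures on $\mathbb{T}^d$. The Fourier coefficients of $\mu$ are $\hat\mu(k)=\int_{\mathbb{T}^d}e^{2\pi i\langle k,\theta\rangle}\,d\mu(\theta)$, $k\in\mathbb{Z}^d$. $\mu$ satisfies a mixing Diophantine condition with parameters $\gamma,\tau>0$ if $|\hat\mu(k)|\le1-\frac{\gamma}{|k|^\tau}$ for all $k\in\mathbb{Z}^d\setminus\{0\}$, where $|\cdot|$ is a fixed norm on $\mathbb{Z}^d$ (e.g. the max norm). The Markov operator is $\mathcal{Q}\varphi(\theta)=\int_{\mathbb{T}^d}\varphi(\theta+\omega_0)\,d\mu(\omega_0)$. $C^\alpha(\mathbb{T}^d)$ is the space of $\alpha$-Hölder continuous functions $\varphi\colon\mathbb{T}^d\to\mathbb{R}$ with norm $\|\varphi\|_\alpha=\|\varphi\|_\infty+\sup_{\theta\ne\theta'}\frac{|\varphi(\theta)-\varphi(\theta')|}{|\theta-\theta'|^\alpha}$, where $|\theta-\theta'|$ is the standard distance on $\mathbb{T}^d$ and $\|\cdot\|_\infty$ is the sup norm. $\mu^{\mathbb{N}}$ is the product measure on sequences $(\omega_i)_{i\ge0}\in(\mathbb{T}^d)^{\mathbb{N}}$. *)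

theory Defs
  imports "HOL-Probability.Probability"
begin

text \<open>
  The torus \<open>\<real>\<^sup>d / \<int>\<^sup>d\<close> is a quotient type over \<^typ>\<open>real ^ 'd\<close>; the dimension is \<open>d = CARD('d)\<close>.
  It is an additive group and a metric space, so \<^term>\<open>borel\<close> is its Borel \<open>\<sigma>\<close>-algebra.
\<close>

definition torus_rel :: "real ^ 'd \<Rightarrow> real ^ 'd \<Rightarrow> bool" where
  "torus_rel x y \<longleftrightarrow> (\<forall>i. x $ i - y $ i \<in> \<int>)"

lemma equivp_torus_rel: "equivp torus_rel"
proof (rule equivpI)
  show "reflp torus_rel" by (simp add: reflp_def torus_rel_def)
  show "symp torus_rel"
    unfolding symp_def torus_rel_def by (metis Ints_minus minus_diff_eq)
  show "transp torus_rel"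
    unfolding transp_def torus_rel_def by (metis Ints_add add_diff_eq diff_add_cancel)
qed

quotient_type 'd torus = "real ^ 'd" / torus_rel
  morphisms rep_torus torus_of
  by (rule equivp_torus_rel)

instantiation torus :: (finite) ab_group_add
begin

lift_definition zero_torus :: "'a torus" is "0" .

lift_definition plus_torus :: "'a torus \<Rightarrow> 'a torus \<Rightarrow> 'a torus" is "(+)"
  unfolding torus_rel_def by (metis Ints_add add_diff_add vector_add_component)

lift_definition uminus_torus :: "'a torus \<Rightarrow> 'a torus" is "uminus"
  unfolding torus_rel_def by (metis Ints_minus minus_diff_minus vector_uminus_component)

definition minus_torus :: "'a torus \<Rightarrow> 'a torus \<Rightarrow> 'a torus" where
  "minus_torus x y = x + (- y)"

instance
proof
  fix a b c :: "'a torus"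
  show "a + b + c = a + (b + c)" by transfer (simp add: torus_rel_def algebra_simps)
  show "a + b = b + a" by transfer (simp add: torus_rel_def algebra_simps)
  show "0 + a = a" by transfer (simp add: torus_rel_def)
  show "- a + a = 0" by transfer (simp add: torus_rel_def)
  show "a - b = a + - b" by (simp add: minus_torus_def)
qed

end

lemma torus_of_add: "torus_of (x + y) = torus_of x + torus_of y"
  by (simp add: plus_torus.abs_eq)

lemma torus_of_minus: "torus_of (- x) = - torus_of x"
  by (simp add: uminus_torus.abs_eq)

lemma torus_of_diff: "torus_of (x - y) = torus_of x - torus_of y"
  using torus_of_add[of x "- y"] by (simp add: torus_of_minus)

lemma torus_of_surj: "\<exists>x. torus_of x = t"
  by (metis Quotient_torus Quotient_abs_rep)

lemma torus_of_eq_iff: "torus_of x = torus_of y \<longleftrightarrow> (\<forall>i. x $ i - y $ i \<in> \<int>)"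
  by (simp add: torus.abs_eq_iff torus_rel_def)

text \<open>The standard distance: the quotient of the Euclidean distance on \<open>\<real>\<^sup>d\<close>.\<close>

instantiation torus :: (finite) metric_space
begin

definition dist_torus :: "'a torus \<Rightarrow> 'a torus \<Rightarrow> real" where
  "dist_torus s t = Inf {dist x y | x y. torus_of x = s \<and> torus_of y = t}"

definition uniformity_torus :: "('a torus \<times> 'a torus) filter" where
  "uniformity_torus = (INF e\<in>{0<..}. principal {(x, y). dist x y < e})"

definition open_torus :: "'a torus set \<Rightarrow> bool" where
  "open_torus U \<longleftrightarrow> (\<forall>x\<in>U. eventually (\<lambda>(x', y). x' = x \<longrightarrow> y \<in> U) uniformity)"

instance
proof
  fix r s t :: "'a torus"
  let ?D = "\<lambda>s t :: 'a torus. {dist x y | x y. torus_of x = s \<and> torus_of y = t}"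
  have ne: "?D s t \<noteq> {}" for s t :: "'a torus"
    using torus_of_surj[of s] torus_of_surj[of t] by blast
  have bdd: "bdd_below (?D s t)" for s t :: "'a torus"
    by (rule bdd_belowI[of _ 0]) auto
  have le: "dist (torus_of x) (torus_of y) \<le> dist x y" for x y :: "real ^ 'a"
    unfolding dist_torus_def by (rule cInf_lower[OF _ bdd]) auto
  have near: "\<exists>x y. torus_of x = s \<and> torus_of y = t \<and> dist x y < e"
    if "dist s t < e" for s t :: "'a torus" and e
    using cInf_lessD[OF ne that[unfolded dist_torus_def]] by blast
  have nonneg: "0 \<le> dist s t" for s t :: "'a torus"
    unfolding dist_torus_def by (rule cInf_greatest[OF ne]) auto
  show "dist s t = 0 \<longleftrightarrow> s = t"
  proof
    assume "s = t"
    then show "dist s t = 0"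
      using le[of "rep_torus s" "rep_torus s"] nonneg[of s s] torus_of_surj[of s] le
      by (metis antisym dist_self)
  next
    assume d0: "dist s t = 0"
    then obtain x y where xy: "torus_of x = s" "torus_of y = t" "dist x y < 1 / 2"
      using near[of s t "1 / 2"] by auto
    have eq: "u - v = x - y" if uv: "torus_of u = s" "torus_of v = t" "dist u v < 1 / 2" for u v
    proof -
      have "torus_of (u - v) = torus_of (x - y)"
        using uv xy by (simp add: torus_of_diff)
      then have Z: "(u - v - (x - y)) $ i \<in> \<int>" for i
        unfolding torus_of_eq_iff by simp
      have "norm (u - v - (x - y)) < 1"
        using norm_triangle_ineq4[of "u - v" "x - y"] uv(3) xy(3) by (simp add: dist_norm)
      then have "\<bar>(u - v - (x - y)) $ i\<bar> < 1" for i
        using component_le_norm_cart[of "u - v - (x - y)" i] by linarith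
      then have "(u - v - (x - y)) $ i = 0" for i
        using Z[of i] Ints_nonzero_abs_less1 by blast
      then show ?thesis by (simp add: vec_eq_iff)
    qed
    have "x = y"
    proof (rule ccontr)
      assume "x \<noteq> y"
      then have pos: "dist x y > 0" by simp
      then obtain u v where uv: "torus_of u = s" "torus_of v = t" "dist u v < dist x y"
        using near[of s t "dist x y"] d0 by auto
      with eq[of u v] xy(3) show False by (simp add: dist_norm)
    qed
    with xy show "s = t" by simp
  qed
  have sym: "dist a b = dist b a" for a b :: "'a torus"
  proof -
    have "?D a b = ?D b a" using dist_commute by blast
    then show ?thesis by (simp add: dist_torus_def)
  qed
  show "dist r s \<le> dist r t + dist s t"
  proof (rule field_le_epsilon)
    fix e :: real assume "e > 0"
    then obtain x y u v where *: "torus_of x = r" "torus_of y = t" "dist x y < dist r t + e / 2"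
        "torus_of u = s" "torus_of v = t" "dist u v < dist s t + e / 2"
      using near[of r t "dist r t + e / 2"] near[of s t "dist s t + e / 2"] by auto
    have "torus_of (u - v + y) = s" using * by (simp add: torus_of_add torus_of_diff)
    then have "dist r s \<le> dist x (u - v + y)" using le[of x "u - v + y"] * by simp
    also have "\<dots> = norm ((x - y) - (u - v))" by (simp add: dist_norm algebra_simps)
    also have "\<dots> \<le> dist x y + dist u v" unfolding dist_norm by (rule norm_triangle_ineq4)
    finally show "dist r s \<le> dist r t + dist s t + e" using * by simp
  qed
qed (simp_all add: uniformity_torus_def open_torus_def)

end

text \<open>The Haar probability measure: Lebesgue measure on the fundamental domain \<open>[0,1)\<^sup>d\<close>,
  pushed forward to the torus.\<close>

definition haar :: "'d::finite torus measure" where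
  "haar = distr (restrict_space lborel {x. \<forall>i. 0 \<le> x $ i \<and> x $ i < 1}) borel torus_of"

definition Prob :: "'d::finite torus measure set" where
  "Prob = {\<mu>. prob_space \<mu> \<and> sets \<mu> = sets borel}"

lift_definition torus_char :: "int ^ 'd \<Rightarrow> 'd torus \<Rightarrow> complex"
  is "\<lambda>k x. exp (2 * of_real pi * \<i> * of_real (\<Sum>j\<in>UNIV. of_int (k $ j) * x $ j))"
proof -
  fix k :: "int ^ 'd" and x y :: "real ^ 'd"
  assume "torus_rel x y"
  then have "(\<Sum>j\<in>UNIV. of_int (k $ j) * (x $ j - y $ j)) \<in> \<int>"
    by (intro Ints_sum Ints_mult) (auto simp: torus_rel_def)
  then obtain m where "(\<Sum>j\<in>UNIV. of_int (k $ j) * (x $ j - y $ j)) = of_int m"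
    by (auto elim: Ints_cases)
  then have m: "(\<Sum>j\<in>UNIV. of_int (k $ j) * x $ j) = (\<Sum>j\<in>UNIV. of_int (k $ j) * y $ j) + of_int m"
    by (simp add: right_diff_distrib sum_subtractf)
  show "exp (2 * of_real pi * \<i> * of_real (\<Sum>j\<in>UNIV. of_int (k $ j) * x $ j)) =
        exp (2 * of_real pi * \<i> * of_real (\<Sum>j\<in>UNIV. of_int (k $ j) * y $ j))"
    unfolding exp_eq m of_real_add by (rule exI[of _ m]) (simp add: algebra_simps)
qed

definition fourier_coeff :: "'d::finite torus measure \<Rightarrow> int ^ 'd \<Rightarrow> complex" where
  "fourier_coeff \<mu> k = (\<integral>\<theta>. torus_char k \<theta> \<partial>\<mu>)"

definition is_norm :: "(int ^ 'd::finite \<Rightarrow> real) \<Rightarrow> bool" where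
  "is_norm N \<longleftrightarrow>
     (\<forall>k. 0 \<le> N k) \<and> (\<forall>k. N k = 0 \<longleftrightarrow> k = 0) \<and>
     (\<forall>a k. N (a *s k) = \<bar>of_int a\<bar> * N k) \<and> (\<forall>k l. N (k + l) \<le> N k + N l)"

definition mixing_DC ::
    "(int ^ 'd::finite \<Rightarrow> real) \<Rightarrow> real \<Rightarrow> real \<Rightarrow> 'd torus measure \<Rightarrow> bool" where
  "mixing_DC N \<gamma> \<tau> \<mu> \<longleftrightarrow> (\<forall>k. k \<noteq> 0 \<longrightarrow> cmod (fourier_coeff \<mu> k) \<le> 1 - \<gamma> / N k powr \<tau>)"

definition markov :: "'d::finite torus measure \<Rightarrow> ('d torus \<Rightarrow> real) \<Rightarrow> 'd torus \<Rightarrow> real" where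
  "markov \<mu> \<phi> \<theta> = (\<integral>\<omega>. \<phi> (\<theta> + \<omega>) \<partial>\<mu>)"

definition sup_norm :: "('d::finite torus \<Rightarrow> real) \<Rightarrow> real" where
  "sup_norm f = (SUP \<theta>. \<bar>f \<theta>\<bar>)"

definition holder_space :: "real \<Rightarrow> ('d::finite torus \<Rightarrow> real) set" where
  "holder_space \<alpha> = {\<phi>. \<exists>K. \<forall>\<theta> \<theta>'. \<bar>\<phi> \<theta> - \<phi> \<theta>'\<bar> \<le> K * dist \<theta> \<theta>' powr \<alpha>}"

definition holder_norm :: "real \<Rightarrow> ('d::finite torus \<Rightarrow> real) \<Rightarrow> real" where
  "holder_norm \<alpha> \<phi> = sup_norm \<phi> +
     Sup {\<bar>\<phi> \<theta> - \<phi> \<theta>'\<bar> / dist \<theta> \<theta>' powr \<alpha> | \<theta> \<theta>'. \<theta> \<noteq> \<theta>'}"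

definition mixing_power_rate ::
    "'d::finite torus measure \<Rightarrow> real \<Rightarrow> real \<Rightarrow> real \<Rightarrow> bool" where
  "mixing_power_rate \<mu> \<alpha> C p \<longleftrightarrow>
     (\<forall>\<phi>\<in>holder_space \<alpha>. \<forall>n::nat. n \<ge> 1 \<longrightarrow>
        sup_norm (\<lambda>\<theta>. (markov \<mu> ^^ n) \<phi> \<theta> - (\<integral>\<theta>'. \<phi> \<theta>' \<partial>haar))
          \<le> C * (1 / real n powr p) * holder_norm \<alpha> \<phi>)"

end

theory Submission
  imports Defs
begin

text \<open>
  Characters are eigenfunctions of the Markov operator: it multiplies the character of frequency
  \<open>k\<close> by the Fourier coefficient \<open>\<mu>\<^sub>k\<close> of the step distribution. The Diophantine condition
  keeps \<open>\<bar>\<mu>\<^sub>k\<bar>\<close> below \<open>exp (- \<gamma> / N k powr \<tau>)\<close>, so on trigonometric polynomials of degree \<open>R\<close> the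
  \<open>n\<close>-th power of the operator approaches the mean at the rate \<open>exp (- c n / R powr \<tau>)\<close>, up to the
  sum of the absolute values of the coefficients.
  
  A Hoelder function is compared with such a polynomial by convolution with a Jackson kernel, the
  fourth power of the absolute value of a Dirichlet kernel. The kernel is a product over the
  coordinates and its second moment is of order \<open>1 / R\<^sup>2\<close> (\<open>jackson_moment_le\<close>), hence the uniform
  distance is of order \<open>R powr - \<alpha>\<close>, while the coefficients grow at most like a power of \<open>R\<close>
  (\<open>jackson_approximation\<close>). The resulting error bound \<open>markov_pow_error\<close> is balanced by letting
  \<open>R\<close> grow like \<open>n powr (1 / \<tau> - \<iota> / \<alpha>)\<close>: the approximation error is then
  \<open>n powr - (\<alpha> / \<tau> - \<iota>)\<close>, and the spectral error decays like a stretched exponential, which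
  absorbs every power of \<open>R\<close>.
  
  For the large deviations, choose \<open>m\<close> so large that the \<open>m\<close>-th power of the operator brings \<open>\<phi>\<close>
  within \<open>\<epsilon> / 4\<close> of its mean. With \<open>h\<close> the sum of the first \<open>m\<close> iterates of \<open>\<phi>\<close> under the operator
  \<open>Q\<close>, one has \<open>\<phi> = (h - Q h) + Q\<^sup>m \<phi>\<close>. Along a path of the walk, the sum of \<open>h - Q h\<close> is a
  martingale with bounded increments up to two boundary terms, so Hoeffding's lemma yields the
  exponential tail (\<open>birkhoff_deviation\<close>). The constants in \<open>markov_pow_error\<close> do not depend on the
  step distribution or on \<open>\<phi>\<close> otherwise than through \<open>\<gamma>\<close>, \<open>\<tau>\<close> and the Hoelder norm, so neither does
  the choice of \<open>m\<close>, and with it the rate.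
\<close>

section \<open>Topology and characters of the torus\<close>

lemma dist_torus_of_le: "dist (torus_of x) (torus_of y) \<le> dist x y"
  for x y :: "real ^ 'd::finite"
  unfolding dist_torus_def by (rule cInf_lower[OF _ bdd_belowI[of _ 0]]) auto

lemma dist_torus_near:
  fixes s t :: "'d::finite torus"
  assumes "dist s t < e"
  obtains x y where "torus_of x = s" "torus_of y = t" "dist x y < e"
proof -
  have "{dist x y | x y. torus_of x = s \<and> torus_of y = t} \<noteq> {}"
    using torus_of_surj[of s] torus_of_surj[of t] by blast
  from cInf_lessD[OF this assms[unfolded dist_torus_def]] that show ?thesis by blast
qed

lemma continuous_on_torus_of: "continuous_on S (torus_of :: real ^ 'd::finite \<Rightarrow> _)"
  unfolding continuous_on_iff using dist_torus_of_le le_less_trans by blast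

lemma measurable_torus_of [measurable]: "(torus_of :: real ^ 'd::finite \<Rightarrow> _) \<in> borel_measurable borel"
  by (rule borel_measurable_continuous_onI[OF continuous_on_torus_of])

lemma torus_nontrivial: "\<exists>x y :: 'd::finite torus. x \<noteq> y"
proof (intro exI notI)
  assume "torus_of (\<chi> i. 1 / 2) = (torus_of 0 :: 'd torus)"
  then have "(1 / 2 :: real) \<in> \<int>" by (simp add: torus_of_eq_iff)
  then show False using Ints_nonzero_abs_less1[of "1 / 2 :: real"] by simp
qed

text \<open>
  Representatives realising a small distance to \<open>torus_of u\<close> can be translated together by a lattice
  vector so that one of them becomes \<open>u\<close> itself.
\<close>

lemma open_torus_of_image:
  fixes U :: "(real ^ 'd::finite) set"
  assumes "open U"
  shows "open (torus_of ` U)"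
  unfolding open_dist
proof (intro ballI)
  fix s assume "s \<in> torus_of ` U"
  then obtain u where u: "u \<in> U" "s = torus_of u" by blast
  with assms obtain e where e: "e > 0" "\<And>v. dist v u < e \<Longrightarrow> v \<in> U"
    unfolding open_dist by blast
  have "t \<in> torus_of ` U" if "dist t s < e" for t
  proof -
    from dist_torus_near[OF that] obtain y x where
      *: "torus_of y = t" "torus_of x = s" "dist y x < e" .
    have "torus_of (y - x + u) = t" using * u by (simp add: torus_of_add torus_of_diff)
    moreover have "y - x + u \<in> U" using e(2)[of "y - x + u"] * by (simp add: dist_norm)
    ultimately show ?thesis by blast
  qed
  with e(1) show "\<exists>e>0. \<forall>t. dist t s < e \<longrightarrow> t \<in> torus_of ` U" by blast
qed

text \<open>
  Second countability makes sums of Borel measurable torus-valued maps measurable. This is what gives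
  measurability of the positions of the random walk as functions of its steps.
\<close>

instance torus :: (finite) second_countable_topology
proof
  obtain B :: "(real ^ 'a) set set" where B: "countable B" "topological_basis B"
    using ex_countable_basis by blast
  have "topological_basis ((`) torus_of ` B)"
  proof (rule topological_basisI)
    show "open S" if "S \<in> (`) torus_of ` B" for S
      using that topological_basis_open[OF B(2)] open_torus_of_image by blast
  next
    fix V and s :: "'a torus" assume V: "open V" "s \<in> V"
    obtain x where x: "torus_of x = s" using torus_of_surj by blast
    have "open (torus_of -` V)"
      by (rule open_vimage[OF V(1) continuous_on_torus_of])
    with x V obtain b where b: "b \<in> B" "x \<in> b" "b \<subseteq> torus_of -` V"
      using topological_basisE[OF B(2), of "torus_of -` V" x] by auto
    then show "\<exists>B'\<in>(`) torus_of ` B. s \<in> B' \<and> B' \<subseteq> V"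
      using x by (intro bexI[of _ "torus_of ` b"]) auto
  qed
  with B(1) show "\<exists>B::'a torus set set. countable B \<and> open = generate_topology B"
    by (intro exI[of _ "(`) torus_of ` B"]) (auto intro: topological_basis_imp_subbasis)
qed

lemma dist_torus_add_le:
  fixes a b c d :: "'d::finite torus"
  shows "dist (a + b) (c + d) \<le> dist a c + dist b d"
proof (rule field_le_epsilon)
  fix e :: real assume "e > 0"
  then have "dist a c < dist a c + e / 2" "dist b d < dist b d + e / 2" by auto
  then obtain x y u v where *: "torus_of x = a" "torus_of y = c" "dist x y < dist a c + e / 2"
     "torus_of u = b" "torus_of v = d" "dist u v < dist b d + e / 2"
    using dist_torus_near by metis
  have "dist (a + b) (c + d) \<le> dist (x + u) (y + v)"
    using dist_torus_of_le[of "x + u" "y + v"] * by (simp add: torus_of_add)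
  also have "\<dots> \<le> dist x y + dist u v" by (rule dist_triangle_add)
  finally show "dist (a + b) (c + d) \<le> dist a c + dist b d + e" using * by simp
qed

instance torus :: (finite) topological_monoid_add
proof
  fix a b :: "'a torus"
  show "((\<lambda>x. fst x + snd x) \<longlongrightarrow> a + b) (nhds a \<times>\<^sub>F nhds b)"
  proof (rule tendstoI)
    fix e :: real assume e: "e > 0"
    have "\<forall>\<^sub>F x in nhds a \<times>\<^sub>F nhds b. dist (fst x) a < e / 2 \<and> dist (snd x) b < e / 2"
      unfolding eventually_prod_filter
      using e by (intro exI[of _ "\<lambda>x. dist x a < e / 2"] exI[of _ "\<lambda>x. dist x b < e / 2"])
        (auto simp: eventually_nhds_metric intro!: exI[of _ "e / 2"])
    then show "\<forall>\<^sub>F x in nhds a \<times>\<^sub>F nhds b. dist (fst x + snd x) (a + b) < e"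
    proof eventually_elim
      case (elim x)
      with dist_torus_add_le[of "fst x" "snd x" a b] show ?case by simp
    qed
  qed
qed

instance torus :: (finite) topological_comm_monoid_add ..

lemma dist_torus_add_right: "dist (a + c) (b + c) = dist a b" for a b c :: "'d::finite torus"
  using dist_torus_add_le[of a c b c] dist_torus_add_le[of "a + c" "- c" "b + c" "- c"] by simp

lemma dist_torus_uminus: "dist (- a) (- b) = dist a b" for a b :: "'d::finite torus"
  using dist_torus_add_right[of "- a" "a + b" "- b"] by (simp add: dist_commute)

instance torus :: (finite) topological_group_add
proof
  fix a :: "'a torus"
  show "(uminus \<longlongrightarrow> - a) (nhds a)"
    by (rule tendstoI) (auto simp: dist_torus_uminus eventually_nhds_metric)
qed

text \<open>
  The Taylor bound gives \<open>sin x \<ge> x - x\<^sup>3 / 6\<close>, and \<open>1 - x\<^sup>2 / 6 \<ge> 1 / 3\<close> on this interval.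
\<close>

lemma quarter_le_sin:
  fixes x :: real
  assumes "0 \<le> x" "x \<le> 2"
  shows "x / 4 \<le> sin x"
proof -
  have "\<bar>sin x - (\<Sum>m<3. sin_coeff m * x ^ m)\<bar> \<le> inverse (fact 3) * \<bar>x\<bar> ^ 3"
    by (rule Maclaurin_sin_bound)
  moreover have "(\<Sum>m<3. sin_coeff m * x ^ m) = x"
    by (simp add: eval_nat_numeral sin_coeff_def)
  ultimately have "\<bar>sin x - x\<bar> \<le> \<bar>x\<bar> ^ 3 / 6"
    by (simp add: fact_numeral field_simps)
  moreover have "x ^ 3 \<le> 4 * x"
    using mult_mono[of x 2 x 2] mult_right_mono[of "x * x" 4 x] assms
    by (simp add: eval_nat_numeral)
  ultimately show ?thesis using assms by (simp add: abs_if split: if_splits)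
qed

text \<open>
  The chord has length \<open>2 \<bar>sin (\<pi> u)\<bar>\<close>.
\<close>

lemma abs_le_cmod_cis_minus_1:
  assumes "\<bar>u\<bar> \<le> 1 / 2"
  shows "\<bar>u\<bar> \<le> cmod (cis (2 * pi * u) - 1)"
proof -
  have "pi * \<bar>u\<bar> \<le> 2"
    using mult_mono[of pi 4 "\<bar>u\<bar>" "1 / 2"] assms pi_less_4 by simp
  then have "pi * \<bar>u\<bar> / 4 \<le> sin (pi * \<bar>u\<bar>)"
    by (intro quarter_le_sin) auto
  also have "sin (pi * \<bar>u\<bar>) \<le> \<bar>sin (pi * u)\<bar>"
    by (cases "u \<ge> 0") auto
  finally have "pi * \<bar>u\<bar> / 4 \<le> \<bar>sin (pi * u)\<bar>" .
  moreover have "cmod (cis (2 * pi * u) - 1) = 2 * \<bar>sin (pi * u)\<bar>"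
    using dist_exp_i_1[of "2 * pi * u"] by (simp add: cis_conv_exp)
  moreover have "\<bar>u\<bar> \<le> pi * \<bar>u\<bar> / 2"
    using mult_right_mono[of 2 pi "\<bar>u\<bar>"] pi_ge_two by simp
  ultimately show ?thesis by linarith
qed

lemma torus_char_torus_of:
  "torus_char k (torus_of x) = cis (2 * pi * (\<Sum>j\<in>UNIV. of_int (k $ j) * x $ j))"
  by (simp add: torus_char.abs_eq cis_conv_exp mult_ac)

lemma torus_char_add_freq: "torus_char (k + l) \<theta> = torus_char k \<theta> * torus_char l \<theta>"
  using torus_of_surj[of \<theta>]
  by (auto simp: torus_char_torus_of cis_mult algebra_simps sum.distrib)

lemma torus_char_add: "torus_char k (\<theta> + \<omega>) = torus_char k \<theta> * torus_char k \<omega>"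
  using torus_of_surj[of \<theta>] torus_of_surj[of \<omega>]
  by (auto simp: torus_char_torus_of cis_mult algebra_simps sum.distrib simp flip: torus_of_add)

lemma torus_char_zero_freq [simp]: "torus_char 0 \<theta> = 1"
  using torus_of_surj[of \<theta>] by (auto simp: torus_char_torus_of)

lemma cmod_torus_char [simp]: "cmod (torus_char k \<theta>) = 1"
  using torus_of_surj[of \<theta>] by (auto simp: torus_char_torus_of)

lemma torus_char_uminus_freq: "torus_char (- k) \<theta> = cnj (torus_char k \<theta>)"
  using torus_of_surj[of \<theta>]
  by (auto simp: torus_char_torus_of cis_cnj sum_negf)

lemma torus_char_uminus: "torus_char k (- \<theta>) = cnj (torus_char k \<theta>)"
  using torus_of_surj[of \<theta>]
  by (auto simp: torus_char_torus_of cis_cnj sum_negf simp flip: torus_of_minus)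

lemma torus_char_diff: "torus_char k (\<theta> - y) = torus_char k \<theta> * cnj (torus_char k y)"
  using torus_char_add[of k \<theta> "- y"] by (simp add: torus_char_uminus)

lemma continuous_on_torus_char: "continuous_on UNIV (torus_char k :: 'd::finite torus \<Rightarrow> complex)"
  unfolding continuous_on_open_vimage[OF open_UNIV]
proof (intro allI impI)
  fix V :: "complex set" assume V: "open V"
  have "continuous_on UNIV (\<lambda>x. torus_char k (torus_of x :: 'd torus))"
    unfolding torus_char_torus_of by (intro continuous_intros)
  with V have "open ((\<lambda>x. torus_char k (torus_of x :: 'd torus)) -` V)"
    by (rule open_vimage)
  then have "open (torus_of ` ((\<lambda>x. torus_char k (torus_of x :: 'd torus)) -` V))"
    by (rule open_torus_of_image)
  also have "torus_of ` ((\<lambda>x. torus_char k (torus_of x :: 'd torus)) -` V) = torus_char k -` V"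
  proof (intro set_eqI iffI)
    fix s :: "'d torus" assume "s \<in> torus_char k -` V"
    moreover obtain x where "torus_of x = s" using torus_of_surj by blast
    ultimately show "s \<in> torus_of ` ((\<lambda>x. torus_char k (torus_of x :: 'd torus)) -` V)"
      by auto
  qed auto
  finally show "open (torus_char k -` V \<inter> (UNIV :: 'd torus set))" by simp
qed

lemma measurable_torus_char [measurable]:
  "(torus_char k :: 'd::finite torus \<Rightarrow> complex) \<in> borel_measurable borel"
  by (rule borel_measurable_continuous_onI[OF continuous_on_torus_char])

text \<open>
  Choose the representative of \<open>\<theta> - y\<close> whose coordinates are at most \<open>1 / 2\<close> in absolute value. The
  point of the bound is that the squares of the summands on the right, unlike the distance, are
  trigonometric polynomials and can be integrated against the kernel.
\<close>

lemma dist_torus_le_sum_char: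
  fixes \<theta> y :: "'d::finite torus"
  shows "dist \<theta> y \<le> (\<Sum>j\<in>UNIV. cmod (torus_char (axis j 1) (\<theta> - y) - 1))"
proof -
  obtain v where v: "torus_of v = \<theta> - y" using torus_of_surj by blast
  define u :: "real ^ 'd" where "u = (\<chi> j. v $ j - of_int (round (v $ j)))"
  have u: "torus_of u = \<theta> - y"
    unfolding v[symmetric] torus_of_eq_iff by (simp add: u_def)
  have small: "\<bar>u $ j\<bar> \<le> 1 / 2" for j
    using of_int_round_abs_le[of "v $ j"] by (simp add: u_def abs_minus_commute)
  have "dist \<theta> y = dist (torus_of u) (torus_of 0)"
    using dist_torus_add_right[of "\<theta> - y" y 0] by (simp add: u zero_torus.abs_eq[symmetric])
  also have "\<dots> \<le> norm u" using dist_torus_of_le[of u 0] by simp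
  also have "\<dots> \<le> (\<Sum>j\<in>UNIV. \<bar>u $ j\<bar>)" by (rule norm_le_l1_cart)
  also have "\<dots> \<le> (\<Sum>j\<in>UNIV. cmod (torus_char (axis j 1) (\<theta> - y) - 1))"
  proof (rule sum_mono)
    fix j :: 'd
    have "(\<Sum>i\<in>UNIV. of_int ((axis j 1 :: int ^ 'd) $ i) * u $ i) = u $ j"
      by (subst sum.remove[of _ j]) (auto simp: axis_def)
    then show "\<bar>u $ j\<bar> \<le> cmod (torus_char (axis j 1) (\<theta> - y) - 1)"
      using abs_le_cmod_cis_minus_1[OF small[of j]] by (simp add: u[symmetric] torus_char_torus_of)
  qed
  finally show ?thesis .
qed

section \<open>Integration against Haar measure\<close>

lemma sets_haar [simp, measurable_cong]: "sets haar = sets borel"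
  by (simp add: haar_def)

lemma space_haar [simp]: "space haar = UNIV"
  by (simp add: haar_def)

lemma bij_betw_axis_Basis: "bij_betw (\<lambda>j. axis j 1) (UNIV :: 'd set) (Basis :: (real ^ 'd::finite) set)"
  by (auto simp: bij_betw_def inj_on_def axis_eq_axis Basis_vec_def)

text \<open>
  Lebesgue measure on \<open>real ^ 'd\<close> is the image of the product measure indexed by the standard basis, so
  this is Fubini's theorem after reindexing the basis by coordinates.
\<close>

lemma lborel_integral_prod:
  fixes h :: "'d::finite \<Rightarrow> real \<Rightarrow> 'b::{real_normed_field,banach,second_countable_topology}"
  assumes h: "\<And>j. integrable lborel (h j)"
  shows "(\<integral>x. (\<Prod>j\<in>UNIV. h j (x $ j)) \<partial>(lborel :: (real ^ 'd) measure)) = (\<Prod>j\<in>UNIV. \<integral>t. h j t \<partial>lborel)"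
proof -
  interpret product_sigma_finite "\<lambda>_ :: real ^ 'd. lborel :: real measure" ..
  define idx :: "real ^ 'd \<Rightarrow> 'd" where "idx = the_inv_into UNIV (\<lambda>j. axis j 1)"
  have idx: "idx (axis j 1) = j" for j
    unfolding idx_def by (rule the_inv_into_f_f) (auto simp: inj_on_def axis_eq_axis)
  have [measurable]: "h j \<in> borel_measurable borel" for j
    using borel_measurable_integrable[OF h[of j]] by simp
  have "(\<integral>x. (\<Prod>j\<in>UNIV. h j (x $ j)) \<partial>(lborel :: (real ^ 'd) measure)) =
      (\<integral>g. (\<Prod>j\<in>UNIV. h j ((\<Sum>b\<in>Basis. g b *\<^sub>R b) $ j)) \<partial>(\<Pi>\<^sub>M b\<in>(Basis :: (real ^ 'd) set). lborel))"
    by (subst lborel_eq, subst integral_distr) simp_all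
  also have "\<dots> = (\<integral>g. (\<Prod>b\<in>Basis. h (idx b) (g b)) \<partial>(\<Pi>\<^sub>M b\<in>(Basis :: (real ^ 'd) set). lborel))"
  proof (intro Bochner_Integration.integral_cong refl)
    fix g :: "real ^ 'd \<Rightarrow> real"
    have "(\<Sum>b\<in>Basis. g b *\<^sub>R b) $ j = g (axis j 1)" for j
      unfolding cart_eq_inner_axis by (rule inner_sum_left_Basis) (simp add: axis_in_Basis_iff)
    then show "(\<Prod>j\<in>UNIV. h j ((\<Sum>b\<in>Basis. g b *\<^sub>R b) $ j)) = (\<Prod>b\<in>Basis. h (idx b) (g b))"
      by (simp add: prod.reindex_bij_betw[OF bij_betw_axis_Basis, symmetric] idx)
  qed
  also have "\<dots> = (\<Prod>b\<in>(Basis :: (real ^ 'd) set). \<integral>t. h (idx b) t \<partial>lborel)"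
    by (rule product_integral_prod) (auto simp: h)
  also have "\<dots> = (\<Prod>j\<in>UNIV. \<integral>t. h j t \<partial>lborel)"
    by (simp add: prod.reindex_bij_betw[OF bij_betw_axis_Basis, symmetric] idx)
  finally show ?thesis .
qed

text \<open>
  Characters and Jackson kernels are both products of functions of one coordinate; this formula
  reduces all of their integrals to integrals over the unit interval.
\<close>

lemma haar_integral_prod:
  fixes f :: "'d::finite \<Rightarrow> real \<Rightarrow> 'b::{real_normed_field,banach,second_countable_topology}"
  assumes f: "\<And>j. continuous_on UNIV (f j)"
    and F [measurable]: "F \<in> borel_measurable borel"
    and F_eq: "\<And>x. F (torus_of x) = (\<Prod>j\<in>UNIV. f j (x $ j))"
  shows "(\<integral>\<theta>. F \<theta> \<partial>haar) = (\<Prod>j\<in>UNIV. LBINT t:{0..1}. f j t)"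
proof -
  let ?C = "{x :: real ^ 'd. \<forall>i. 0 \<le> x $ i \<and> x $ i < 1}"
  let ?h = "\<lambda>j t. indicator {0..<1} t *\<^sub>R f j t"
  have [measurable]: "f j \<in> borel_measurable borel" for j
    using f by (rule borel_measurable_continuous_onI)
  have int1: "integrable lborel (\<lambda>t. indicator {0..1} t *\<^sub>R f j t)" for j
    using borel_integrable_atLeastAtMost'[of 0 1 "f j"] continuous_on_subset[OF f]
    by (simp add: set_integrable_def)
  \<comment> \<open>The fundamental domain is half open; the closed interval differs from it by a null set.\<close>
  have AE: "AE t in lborel. ?h j t = indicator {0..1} t *\<^sub>R f j t" for j
    using AE_lborel_singleton[of "1 :: real"] by eventually_elim (auto simp: indicator_def)
  have C: "?C \<in> sets borel"
    using measurable_sets_borel by measurable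
  have "(\<integral>\<theta>. F \<theta> \<partial>haar) = (\<integral>x. F (torus_of x) \<partial>restrict_space lborel ?C)"
    unfolding haar_def by (subst integral_distr) (auto intro: measurable_restrict_space1)
  also have "\<dots> = (\<integral>x. indicator ?C x *\<^sub>R F (torus_of x) \<partial>lborel)"
    by (rule integral_restrict_space) (use C in auto)
  also have "\<dots> = (\<integral>x. (\<Prod>j\<in>UNIV. ?h j (x $ j)) \<partial>lborel)"
  proof (intro Bochner_Integration.integral_cong refl)
    fix x :: "real ^ 'd"
    show "indicator ?C x *\<^sub>R F (torus_of x) = (\<Prod>j\<in>UNIV. ?h j (x $ j))"
    proof (cases "x \<in> ?C")
      case True
      then show ?thesis by (simp add: F_eq)
    next
      case False
      then obtain j where "x $ j \<notin> {0..<1}" by fastforce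
      then have "?h j (x $ j) = 0" by simp
      then have "(\<Prod>j\<in>UNIV. ?h j (x $ j)) = 0" by (intro prod_zero finite bexI[of _ j]) auto
      with False show ?thesis by simp
    qed
  qed
  also have "\<dots> = (\<Prod>j\<in>UNIV. \<integral>t. ?h j t \<partial>lborel)"
  proof (rule lborel_integral_prod)
    fix j
    show "integrable lborel (?h j)"
      by (rule integrable_cong_AE_imp[OF int1[of j]]) (use AE[of j] in auto)
  qed
  also have "\<dots> = (\<Prod>j\<in>UNIV. LBINT t:{0..1}. f j t)"
    unfolding set_lebesgue_integral_def
    by (intro prod.cong refl integral_cong_AE) (use AE in auto)
  finally show ?thesis .
qed

lemma prob_space_haar: "prob_space (haar :: 'd::finite torus measure)"
proof
  have "(\<integral>\<theta>. 1 \<partial>(haar :: 'd torus measure)) = (\<Prod>j\<in>(UNIV::'d set). LBINT t:{0..1::real}. 1 :: real)"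
    by (rule haar_integral_prod) auto
  then have "measure (haar :: 'd torus measure) UNIV = 1" by (simp add: set_lebesgue_integral_def)
  then show "emeasure (haar :: 'd torus measure) (space haar) = 1"
    by (subst emeasure_eq_ennreal_measure) (auto simp: measure_def)
qed

interpretation haar: prob_space haar
  by (rule prob_space_haar)

lemma unit_integral_cis:
  fixes k :: int
  shows "(LBINT t:{0..1}. cis (2 * pi * (of_int k * t))) = (if k = 0 then 1 else 0)"
proof (cases "k = 0")
  case True
  then show ?thesis by (simp add: set_lebesgue_integral_def)
next
  case False
  let ?F = "\<lambda>t. exp (2 * pi * \<i> * of_int k * of_real t) / (2 * pi * \<i> * of_int k)"
  have "(LBINT t:{0..1}. cis (2 * pi * (of_int k * t))) = ?F 1 - ?F 0"
    unfolding set_lebesgue_integral_def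
  proof (rule integral_FTC_Icc)
    fix t :: real
    have "(?F has_vector_derivative exp (2 * pi * \<i> * of_int k * of_real t)) (at t within {0..1})"
      using False by (auto intro!: derivative_eq_intros has_vector_derivative_real_field)
    then show "(?F has_vector_derivative cis (2 * pi * (of_int k * t))) (at t within {0..1})"
      by (simp add: cis_conv_exp mult_ac)
  qed (auto intro!: continuous_intros)
  also have "exp (2 * pi * \<i> * of_int k * of_real 1) = (1 :: complex)"
    using exp_integer_2pi[of "of_int k"] by (simp add: mult_ac)
  finally show ?thesis using False by simp
qed

lemma haar_integral_char:
  "(\<integral>\<theta>. torus_char k \<theta> \<partial>haar) = (if k = 0 then 1 else 0)"
proof -
  have "(\<integral>\<theta>. torus_char k \<theta> \<partial>haar) = (\<Prod>j\<in>UNIV. LBINT t:{0..1}. cis (2 * pi * (of_int (k $ j) * t)))"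
    by (rule haar_integral_prod)
      (auto simp: torus_char_torus_of cis_conv_exp sum_distrib_left exp_sum intro!: continuous_intros)
  also have "\<dots> = (if k = 0 then 1 else 0)"
    by (auto simp: unit_integral_cis vec_eq_iff)
  finally show ?thesis .
qed

text \<open>
  A shift of the frequencies multiplies the sum by a factor of modulus one, so after taking absolute
  values the one-sided range of frequencies is as good as a symmetric one.
\<close>

definition dirichlet_abs :: "nat \<Rightarrow> real \<Rightarrow> real" where
  "dirichlet_abs R t = cmod (\<Sum>a<R. cis (2 * pi * (real a * t)))"

lemma continuous_on_dirichlet_abs [continuous_intros]: "continuous_on S (dirichlet_abs R)"
  unfolding dirichlet_abs_def by (intro continuous_intros)

text \<open>
  Parseval: expanding the square, only the \<open>R\<close> diagonal terms survive the integration.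
\<close>

lemma unit_integral_dirichlet_sq: "(LBINT t:{0..1}. dirichlet_abs R t ^ 2) = real R"
proof -
  have int: "set_integrable lborel {0..1} (\<lambda>t. cis (2 * pi * (of_int k * t)))" for k :: int
    by (rule borel_integrable_atLeastAtMost') (intro continuous_intros)
  have "complex_of_real (LBINT t:{0..1}. dirichlet_abs R t ^ 2) =
      (LBINT t:{0..1}. complex_of_real (dirichlet_abs R t ^ 2))"
    by (rule set_integral_complex_of_real[symmetric])
  also have "\<dots> = (LBINT t:{0..1}. \<Sum>a<R. \<Sum>b<R. cis (2 * pi * (of_int (int a - int b) * t)))"
    unfolding dirichlet_abs_def complex_norm_square cnj_sum cis_cnj sum_product cis_mult
    by (simp add: algebra_simps)
  also have "\<dots> = (\<Sum>a<R. \<Sum>b<R. LBINT t:{0..1}. cis (2 * pi * (of_int (int a - int b) * t)))"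
    using int unfolding set_integrable_def set_lebesgue_integral_def scaleR_sum_right
    by (simp only: Bochner_Integration.integral_sum Bochner_Integration.integrable_sum)
  also have "\<dots> = (\<Sum>a<R. \<Sum>b<R. if a = b then 1 else 0)"
    unfolding unit_integral_cis by (intro sum.cong refl) auto
  also have "\<dots> = of_nat R" by simp
  finally show ?thesis by (metis of_real_eq_iff of_real_of_nat_eq)
qed

text \<open>
  All \<open>R\<close> angles are at most \<open>\<pi> / 4\<close>, so every summand has real part at least \<open>1 / 2\<close> and nothing
  cancels.
\<close>

lemma half_le_dirichlet_abs:
  assumes "0 \<le> t" "t \<le> 1 / (8 * real R)" "R \<ge> 1"
  shows "real R / 2 \<le> dirichlet_abs R t"
proof -
  have "1 / 2 \<le> cos (2 * pi * (real a * t))" if "a < R" for a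
  proof -
    have "real a * t \<le> real R * (1 / (8 * real R))"
      using that assms by (intro mult_mono) auto
    also have "\<dots> = 1 / 8" using assms by simp
    finally have "2 * pi * (real a * t) \<le> 2 * pi * (1 / 8)" by (intro mult_left_mono) auto
    then have "2 * pi * (real a * t) \<le> pi / 3" by simp
    then have "cos (pi / 3) \<le> cos (2 * pi * (real a * t))"
      using assms by (intro cos_monotone_0_pi_le) auto
    then show ?thesis by (simp add: cos_60)
  qed
  then have "(\<Sum>a<R. 1 / 2) \<le> (\<Sum>a<R. cos (2 * pi * (real a * t)))"
    by (intro sum_mono) auto
  also have "\<dots> = Re (\<Sum>a<R. cis (2 * pi * (real a * t)))" by simp
  also have "\<dots> \<le> dirichlet_abs R t" unfolding dirichlet_abs_def by (rule complex_Re_le_cmod)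
  finally show ?thesis by simp
qed

text \<open>
  The peak at the origin, of height \<open>R / 2\<close> and width \<open>1 / (8 R)\<close>, already carries mass of
  order \<open>R\<^sup>3\<close>.
\<close>

lemma unit_integral_dirichlet_fourth_ge:
  assumes "R \<ge> 1"
  shows "real R ^ 3 / 128 \<le> (LBINT t:{0..1}. dirichlet_abs R t ^ 4)"
proof -
  let ?a = "1 / (8 * real R)"
  have "real R ^ 3 / 128 = (real R / 2) ^ 4 * ?a"
    using assms by (simp add: power_divide eval_nat_numeral)
  also have "\<dots> = (LBINT t:{0..?a}. (real R / 2) ^ 4)"
    by (simp add: set_lebesgue_integral_def)
  also have "\<dots> \<le> (LBINT t:{0..1}. dirichlet_abs R t ^ 4)"
    unfolding set_lebesgue_integral_def
  proof (rule integral_mono)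
    show "integrable lborel (\<lambda>t. indicator {0..1} t *\<^sub>R dirichlet_abs R t ^ 4)"
      using borel_integrable_atLeastAtMost'[of 0 1 "\<lambda>t. dirichlet_abs R t ^ 4"]
      by (simp only: set_integrable_def) (auto intro!: continuous_intros)
    fix t
    show "indicator {0..?a} t *\<^sub>R (real R / 2) ^ 4 \<le> indicator {0..1} t *\<^sub>R dirichlet_abs R t ^ 4"
    proof (cases "t \<in> {0..?a}")
      case True
      moreover have "?a \<le> 1" using assms by simp
      ultimately have "t \<in> {0..1}" by auto
      with True show ?thesis
        using half_le_dirichlet_abs[of t R] assms power_mono[of "real R / 2" "dirichlet_abs R t" 4]
        by simp
    qed simp
  qed (auto intro!: integrable_mult_left)
  finally show ?thesis .
qed

section \<open>Trigonometric polynomials\<close>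

lemma (in prob_space) norm_expectation_le:
  fixes f :: "'a \<Rightarrow> 'b::{banach, second_countable_topology}"
  assumes "integrable M f" "\<And>x. x \<in> space M \<Longrightarrow> norm (f x) \<le> B"
  shows "norm (\<integral>x. f x \<partial>M) \<le> B"
  using assms by (intro order_trans[OF integral_norm_bound] integral_le_const) auto

lemma integrable_bounded_mult_left:
  fixes f g :: "'a \<Rightarrow> real"
  assumes f: "integrable M f" and [measurable]: "g \<in> borel_measurable M" and B: "\<And>x. \<bar>g x\<bar> \<le> B"
  shows "integrable M (\<lambda>x. g x * f x)"
proof (rule Bochner_Integration.integrable_bound)
  show "integrable M (\<lambda>x. B * f x)" using f by (rule integrable_mult_right)
  show "(\<lambda>x. g x * f x) \<in> borel_measurable M" using f by measurable
  have "0 \<le> B" using B order_trans[OF abs_ge_zero] by blast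
  then show "AE x in M. norm (g x * f x) \<le> norm (B * f x)"
    using B by (intro AE_I2) (simp add: abs_mult mult_right_mono)
qed

lemma measurable_cnj [measurable]: "cnj \<in> borel_measurable borel"
  by (intro borel_measurable_continuous_onI continuous_intros)

lemma measurable_torus_uminus [measurable]:
  "(uminus :: 'd::finite torus \<Rightarrow> _) \<in> borel_measurable borel"
  by (intro borel_measurable_continuous_onI continuous_intros)

text \<open>
  \<open>R\<close> bounds the frequencies in the maximum norm and \<open>M\<close> the sum of the absolute values of the
  coefficients. Both are recorded because the distance of an iterate of the Markov operator to the mean
  is at most \<open>M\<close> times a power of the largest Fourier coefficient of the step distribution at the
  nonzero frequencies up to \<open>R\<close>. The functions are real since the Markov operator acts on real functions.
\<close>

inductive trig_poly :: "real \<Rightarrow> real \<Rightarrow> ('d::finite torus \<Rightarrow> real) \<Rightarrow> bool" for R where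
  wave: "(\<And>j. \<bar>real_of_int (k $ j)\<bar> \<le> R) \<Longrightarrow> cmod c \<le> M \<Longrightarrow>
    trig_poly R M (\<lambda>\<theta>. Re (c * torus_char k \<theta>))"
| add: "trig_poly R M f \<Longrightarrow> trig_poly R M' g \<Longrightarrow> trig_poly R (M + M') (\<lambda>\<theta>. f \<theta> + g \<theta>)"

lemma trig_poly_measurable: "trig_poly R M f \<Longrightarrow> f \<in> borel_measurable borel"
  by (induction rule: trig_poly.induct) auto

lemma trig_poly_bound: "trig_poly R M f \<Longrightarrow> \<bar>f \<theta>\<bar> \<le> M"
proof (induction rule: trig_poly.induct)
  case (wave k c M)
  have "\<bar>Re (c * torus_char k \<theta>)\<bar> \<le> cmod (c * torus_char k \<theta>)" by (rule abs_Re_le_cmod)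
  with wave show ?case by (simp add: norm_mult)
qed auto

lemma trig_poly_const: "0 \<le> R \<Longrightarrow> \<bar>a\<bar> \<le> M \<Longrightarrow> trig_poly R M (\<lambda>_. a)"
  using trig_poly.wave[of 0 R "of_real a" M] by simp

lemma trig_poly_degree_nonneg: "trig_poly R M f \<Longrightarrow> 0 \<le> R"
proof (induction rule: trig_poly.induct)
  case (wave k c M)
  \<comment> \<open>Index types are nonempty, so some coordinate witnesses the bound.\<close>
  from wave(1)[of undefined] show ?case by linarith
qed auto

lemma trig_poly_mono:
  assumes "trig_poly R M f" "R \<le> R'" "M \<le> M'"
  shows "trig_poly R' M' f"
proof -
  have "trig_poly R' M f" using assms(1)
  proof (induction rule: trig_poly.induct)
    case (wave k c M)
    from wave(1) assms(2) have "\<bar>real_of_int (k $ j)\<bar> \<le> R'" for j by (rule order_trans)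
    then show ?case using wave(2) by (rule trig_poly.wave)
  qed (rule trig_poly.add)
  moreover have "trig_poly R' (M' - M) (\<lambda>_. 0)"
    using assms trig_poly_degree_nonneg[OF assms(1)] by (intro trig_poly_const) auto
  ultimately have "trig_poly R' (M + (M' - M)) (\<lambda>\<theta>. f \<theta> + 0)" by (rule trig_poly.add)
  then show ?thesis by simp
qed

lemma trig_poly_scale: "trig_poly R M f \<Longrightarrow> trig_poly R (\<bar>a\<bar> * M) (\<lambda>\<theta>. a * f \<theta>)"
proof (induction rule: trig_poly.induct)
  case (wave k c M)
  have "trig_poly R (\<bar>a\<bar> * M) (\<lambda>\<theta>. Re (of_real a * c * torus_char k \<theta>))"
    using wave by (intro trig_poly.wave) (auto simp: norm_mult mult_left_mono)
  then show ?case by (simp add: mult.assoc)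
next
  case (add M f M' g)
  from trig_poly.add[OF add.IH] show ?case by (simp add: algebra_simps)
qed

lemma trig_poly_sum:
  assumes "finite I" "0 \<le> R" "\<And>i. i \<in> I \<Longrightarrow> trig_poly R (M i) (f i)"
  shows "trig_poly R (\<Sum>i\<in>I. M i) (\<lambda>\<theta>. \<Sum>i\<in>I. f i \<theta>)"
  using assms by (induction) (auto intro: trig_poly_const trig_poly.add)

text \<open>
  Real parts of waves multiply by \<open>Re z * Re w = (Re (z w) + Re (z cnj w)) / 2\<close>, so that both the
  sum and the difference of the frequencies occur.
\<close>

lemma trig_poly_wave_mult:
  assumes k: "\<And>j. \<bar>real_of_int (k $ j)\<bar> \<le> R" and c: "cmod c \<le> M" and g: "trig_poly R' M' g"
  shows "trig_poly (R + R') (M * M') (\<lambda>\<theta>. Re (c * torus_char k \<theta>) * g \<theta>)"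
  using g
proof (induction rule: trig_poly.induct)
  case (wave l d N)
  have M: "0 \<le> M" using c norm_ge_zero order_trans by blast
  have N: "cmod c * cmod d \<le> M * N"
    using c wave M by (intro mult_mono) auto
  have kl: "\<bar>real_of_int (k $ j) + real_of_int (l $ j)\<bar> \<le> R + R'"
    "\<bar>real_of_int (k $ j) - real_of_int (l $ j)\<bar> \<le> R + R'" for j
    using k[of j] wave(1)[of j] by linarith+
  have "trig_poly (R + R') (M * N / 2) (\<lambda>\<theta>. Re (c * d / 2 * torus_char (k + l) \<theta>))"
    using N kl by (intro trig_poly.wave) (auto simp: norm_mult norm_divide)
  moreover have "trig_poly (R + R') (M * N / 2) (\<lambda>\<theta>. Re (c * cnj d / 2 * torus_char (k + - l) \<theta>))"
    using N kl by (intro trig_poly.wave) (auto simp: norm_mult norm_divide)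
  ultimately have "trig_poly (R + R') (M * N / 2 + M * N / 2)
      (\<lambda>\<theta>. Re (c * d / 2 * torus_char (k + l) \<theta>) + Re (c * cnj d / 2 * torus_char (k + - l) \<theta>))"
    by (rule trig_poly.add)
  moreover have "Re (c * d / 2 * torus_char (k + l) \<theta>) + Re (c * cnj d / 2 * torus_char (k + - l) \<theta>)
      = Re (c * torus_char k \<theta>) * Re (d * torus_char l \<theta>)" for \<theta>
  proof -
    define z w where "z = c * torus_char k \<theta>" and "w = d * torus_char l \<theta>"
    have "c * d / 2 * torus_char (k + l) \<theta> = z * w / 2"
      "c * cnj d / 2 * torus_char (k + - l) \<theta> = z * cnj w / 2"
      by (simp_all add: z_def w_def torus_char_add_freq torus_char_uminus_freq del: add_uminus_conv_diff)
    then show ?thesis unfolding z_def[symmetric] w_def[symmetric]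
      by (simp add: field_simps)
  qed
  ultimately show ?case by simp
next
  case (add N f N' g)
  from trig_poly.add[OF add.IH] show ?case by (simp add: algebra_simps)
qed

lemma trig_poly_mult:
  assumes f: "trig_poly R M f" and g: "trig_poly R' M' g"
  shows "trig_poly (R + R') (M * M') (\<lambda>\<theta>. f \<theta> * g \<theta>)"
  using f
proof (induction rule: trig_poly.induct)
  case (wave k c M)
  then show ?case using g by (intro trig_poly_wave_mult)
next
  case (add N f N' h)
  from trig_poly.add[OF add.IH] show ?case by (simp add: algebra_simps)
qed

lemma trig_poly_prod:
  assumes "finite I" "\<And>i. i \<in> I \<Longrightarrow> trig_poly (R i) (M i) (f i)"
  shows "trig_poly (\<Sum>i\<in>I. R i) (\<Prod>i\<in>I. M i) (\<lambda>\<theta>. \<Prod>i\<in>I. f i \<theta>)"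
  using assms by (induction) (auto intro: trig_poly_const trig_poly_mult)

lemma integrable_trig_poly_diff:
  assumes "trig_poly R M f"
  shows "integrable haar (\<lambda>y. f (\<theta> - y))"
proof (rule haar.integrable_const_bound[of _ M])
  have [measurable]: "f \<in> borel_measurable borel" by (rule trig_poly_measurable[OF assms])
  show "(\<lambda>y. f (\<theta> - y)) \<in> borel_measurable haar"
    unfolding diff_conv_add_uminus by measurable
qed (use trig_poly_bound[OF assms] in auto)

lemma integrable_trig_poly:
  assumes "trig_poly R M f"
  shows "integrable haar f"
  using trig_poly_measurable[OF assms] trig_poly_bound[OF assms]
  by (intro haar.integrable_const_bound[of _ M]) auto

lemma integrable_torus_char: "integrable haar (torus_char k)"
  by (rule haar.integrable_const_bound[of _ 1]) auto

text \<open>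
  Invariance of Haar measure under reflection and translation, on trigonometric polynomials: the
  substitution turns a nonconstant wave into another nonconstant wave, and both integrate to zero.
\<close>

lemma haar_integral_trig_poly_diff:
  assumes "trig_poly R M f"
  shows "(\<integral>y. f (\<theta> - y) \<partial>haar) = (\<integral>y. f y \<partial>haar)"
  using assms
proof (induction rule: trig_poly.induct)
  case (wave k c M)
  have "(\<integral>y. Re (c * torus_char k (\<theta> - y)) \<partial>haar) = Re (\<integral>y. c * torus_char k \<theta> * cnj (torus_char k y) \<partial>haar)"
    unfolding torus_char_diff mult.assoc[symmetric]
    by (rule integral_Re) (intro integrable_mult_right integrable_cnj integrable_torus_char)
  also have "\<dots> = Re (c * torus_char k \<theta> * cnj (\<integral>y. torus_char k y \<partial>haar))"
    by simp
  also have "\<dots> = Re (\<integral>y. c * torus_char k y \<partial>haar)"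
    by (simp add: haar_integral_char)
  also have "\<dots> = (\<integral>y. Re (c * torus_char k y) \<partial>haar)"
    by (rule integral_Re[symmetric]) (intro integrable_mult_right integrable_torus_char)
  finally show ?case .
next
  case (add M f M' g)
  then show ?case by (simp add: integrable_trig_poly_diff integrable_trig_poly)
qed

text \<open>
  Convolution with \<open>\<phi>\<close> multiplies the coefficient at frequency \<open>k\<close> by a Fourier coefficient of \<open>\<phi>\<close>,
  which is at most \<open>B\<close>.
\<close>

lemma trig_poly_convolution:
  fixes \<phi> :: "'d::finite torus \<Rightarrow> real"
  assumes f: "trig_poly R M f"
    and [measurable]: "\<phi> \<in> borel_measurable borel" and B: "\<And>\<theta>. \<bar>\<phi> \<theta>\<bar> \<le> B"
  shows "trig_poly R (B * M) (\<lambda>\<theta>. \<integral>y. \<phi> y * f (\<theta> - y) \<partial>haar)"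
  using f
proof (induction rule: trig_poly.induct)
  case (wave k c M)
  have B0: "0 \<le> B" using B[of 0] by linarith
  have int: "integrable haar (\<lambda>y. of_real (\<phi> y) * cnj (torus_char k y))"
    using B by (intro haar.integrable_const_bound[of _ B]) (auto simp: norm_mult)
  define I where "I = (\<integral>y. of_real (\<phi> y) * cnj (torus_char k y) \<partial>haar)"
  have I: "cmod I \<le> B" unfolding I_def
    using B by (intro haar.norm_expectation_le int) (auto simp: norm_mult)
  have eq: "(\<integral>y. \<phi> y * Re (c * torus_char k (\<theta> - y)) \<partial>haar) = Re (c * I * torus_char k \<theta>)" for \<theta>
  proof -
    have "(\<integral>y. \<phi> y * Re (c * torus_char k (\<theta> - y)) \<partial>haar) =
        (\<integral>y. Re ((c * torus_char k \<theta>) * (of_real (\<phi> y) * cnj (torus_char k y))) \<partial>haar)"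
      by (intro Bochner_Integration.integral_cong refl) (simp add: torus_char_diff algebra_simps)
    also have "\<dots> = Re (\<integral>y. (c * torus_char k \<theta>) * (of_real (\<phi> y) * cnj (torus_char k y)) \<partial>haar)"
      by (rule integral_Re) (intro integrable_mult_right int)
    also have "\<dots> = Re (c * I * torus_char k \<theta>)"
      by (simp add: I_def mult_ac)
    finally show ?thesis .
  qed
  have "cmod (c * I) \<le> B * M"
    using I wave(2) B0 mult_mono[of "cmod I" B "cmod c" M] by (simp add: norm_mult mult.commute)
  with wave(1) show ?case unfolding eq by (rule trig_poly.wave)
next
  case (add M f M' g)
  have int: "integrable haar (\<lambda>y. \<phi> y * h (\<theta> - y))" if "trig_poly R N h" for N h \<theta>
    using B by (intro integrable_bounded_mult_left[OF integrable_trig_poly_diff[OF that]]) auto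
  from trig_poly.add[OF add.IH] show ?case
    using int[OF add.hyps(1)] int[OF add.hyps(2)] by (simp add: algebra_simps)
qed

section \<open>The Jackson kernel\<close>

text \<open>
  Without normalisation: \<open>R\<close> times the classical Fejer kernel in the coordinate \<open>j\<close>.
\<close>

definition fejer :: "nat \<Rightarrow> 'd \<Rightarrow> 'd::finite torus \<Rightarrow> real" where
  "fejer R j \<theta> = (cmod (\<Sum>a<R. torus_char (axis j (int a)) \<theta>))\<^sup>2"

text \<open>
  The product of one-dimensional Jackson kernels, again not normalised. Squaring the Fejer kernel is
  what makes the second moment small: the Fejer kernel itself has second moment of order \<open>1 / R\<close> only.
\<close>

definition jackson :: "nat \<Rightarrow> 'd::finite torus \<Rightarrow> real" where
  "jackson R \<theta> = (\<Prod>j\<in>UNIV. (fejer R j \<theta>)\<^sup>2)"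

definition dirichlet_mass :: "nat \<Rightarrow> real" where
  "dirichlet_mass R = (LBINT t:{0..1}. dirichlet_abs R t ^ 4)"

lemma torus_char_axis_torus_of:
  "torus_char (axis j a) (torus_of x) = cis (2 * pi * (of_int a * x $ j))"
proof -
  have "(\<Sum>i\<in>UNIV. of_int (axis j a $ i) * x $ i) = of_int a * x $ j"
    by (subst sum.remove[of _ j]) (auto simp: axis_def)
  then show ?thesis by (simp add: torus_char_torus_of)
qed

lemma torus_char_axis_power: "torus_char (axis j (int a)) \<theta> = torus_char (axis j 1) \<theta> ^ a"
  using torus_of_surj[of \<theta>]
  by (auto simp: torus_char_axis_torus_of Complex.DeMoivre mult_ac)

lemma torus_char_axis_diff:
  "torus_char (axis j (a - b)) \<theta> = torus_char (axis j a) \<theta> * cnj (torus_char (axis j b) \<theta>)"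
  using torus_of_surj[of \<theta>]
  by (auto simp: torus_char_axis_torus_of cis_cnj cis_mult algebra_simps)

lemma fejer_torus_of: "fejer R j (torus_of x) = dirichlet_abs R (x $ j) ^ 2"
  by (simp add: fejer_def dirichlet_abs_def torus_char_axis_torus_of)

lemma fejer_nonneg: "0 \<le> fejer R j \<theta>"
  by (simp add: fejer_def)

lemma jackson_nonneg: "0 \<le> jackson R \<theta>"
  by (simp add: jackson_def prod_nonneg)

lemma trig_poly_fejer: "trig_poly (real R) (real R ^ 2) (fejer R j)"
proof -
  have "fejer R j = (\<lambda>\<theta>. \<Sum>a<R. \<Sum>b<R. Re (1 * torus_char (axis j (int a - int b)) \<theta>))"
  proof
    fix \<theta>
    have "complex_of_real (fejer R j \<theta>) = (\<Sum>a<R. \<Sum>b<R. torus_char (axis j (int a - int b)) \<theta>)"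
      unfolding fejer_def complex_norm_square cnj_sum sum_product torus_char_axis_diff ..
    from arg_cong[OF this, of Re]
    show "fejer R j \<theta> = (\<Sum>a<R. \<Sum>b<R. Re (1 * torus_char (axis j (int a - int b)) \<theta>))" by simp
  qed
  moreover have "trig_poly (real R) (\<Sum>a<R. \<Sum>b<R. 1)
      (\<lambda>\<theta>. \<Sum>a<R. \<Sum>b<R. Re (1 * torus_char (axis j (int a - int b)) \<theta>))"
    by (intro trig_poly_sum trig_poly.wave) (auto simp: axis_def)
  ultimately show ?thesis by (simp add: power2_eq_square)
qed

lemma trig_poly_fejer_sq:
  "trig_poly (real R + real R) (real R ^ 2 * real R ^ 2) (\<lambda>\<theta>. (fejer R j \<theta>)\<^sup>2)"
  unfolding power2_eq_square[of "fejer _ _ _"] by (intro trig_poly_mult trig_poly_fejer)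

lemma trig_poly_jackson:
  "trig_poly (2 * real CARD('d) * real R) (real R ^ (4 * CARD('d))) (jackson R :: 'd::finite torus \<Rightarrow> real)"
proof -
  have "trig_poly (\<Sum>j\<in>(UNIV :: 'd set). real R + real R) (\<Prod>j\<in>(UNIV :: 'd set). real R ^ 2 * real R ^ 2)
      (\<lambda>\<theta>. \<Prod>j\<in>(UNIV :: 'd set). (fejer R j \<theta>)\<^sup>2)"
    using trig_poly_fejer_sq[of R] by (intro trig_poly_prod) auto
  then show ?thesis
    by (simp add: jackson_def[abs_def] mult_ac flip: power_add power_mult)
qed

lemma haar_integral_jackson:
  "(\<integral>\<theta>. jackson R \<theta> \<partial>(haar :: 'd::finite torus measure)) = dirichlet_mass R ^ CARD('d)"
proof -
  have "(\<integral>\<theta>. jackson R \<theta> \<partial>(haar :: 'd torus measure)) = (\<Prod>j\<in>(UNIV :: 'd set). dirichlet_mass R)"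
    unfolding dirichlet_mass_def
  proof (rule haar_integral_prod)
    show "jackson R \<in> borel_measurable borel"
      by (rule trig_poly_measurable[OF trig_poly_jackson])
  qed (auto simp: jackson_def fejer_torus_of power_mult[symmetric] intro!: continuous_intros)
  then show ?thesis by simp
qed

lemma dirichlet_mass_ge: "R \<ge> 1 \<Longrightarrow> real R ^ 3 / 128 \<le> dirichlet_mass R"
  unfolding dirichlet_mass_def by (rule unit_integral_dirichlet_fourth_ge)

text \<open>
  Summing the geometric series, \<open>(z - 1) * (\<Sum>a<R. z ^ a) = z ^ R - 1\<close>, and the right-hand side has
  modulus at most \<open>2\<close>.
\<close>

lemma cmod_char_minus_1_mult_fejer:
  "(cmod (torus_char (axis j 1) \<theta> - 1))\<^sup>2 * fejer R j \<theta> \<le> 4"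
proof -
  let ?z = "torus_char (axis j 1) \<theta>"
  have "cmod (?z - 1) * cmod (\<Sum>a<R. ?z ^ a) = cmod (?z ^ R - 1)"
    by (simp add: norm_mult[symmetric] power_diff_1_eq)
  also have "\<dots> \<le> 2"
    using norm_triangle_ineq4[of "?z ^ R" 1] by (simp add: norm_power)
  finally have "(cmod (?z - 1) * cmod (\<Sum>a<R. ?z ^ a))\<^sup>2 \<le> 2\<^sup>2"
    by (intro power_mono) auto
  then show ?thesis
    by (simp add: fejer_def torus_char_axis_power power_mult_distrib)
qed

text \<open>
  Degree and mass are left open: the statement only serves to make the moment of the kernel
  integrable and independent of the point at which the kernel is centred.
\<close>

lemma trig_poly_moment:
  "\<exists>S M. trig_poly S M (\<lambda>\<theta>. jackson R \<theta> * (cmod (torus_char (axis j 1) \<theta> - 1))\<^sup>2)"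
proof -
  have "trig_poly 1 4 (\<lambda>\<theta> :: 'a torus. 2 + Re (- 2 * torus_char (axis j 1) \<theta>))"
    using trig_poly.add[OF trig_poly_const[of 1 2 2] trig_poly.wave[of "axis j 1 :: int ^ 'a" 1 "-2" 2]]
    by (simp add: axis_def)
  moreover have "(cmod (torus_char (axis j 1) \<theta> - 1))\<^sup>2 = 2 + Re (- 2 * torus_char (axis j 1) \<theta>)" for \<theta>
  proof -
    let ?z = "torus_char (axis j 1) \<theta>"
    have "(Re ?z)\<^sup>2 + (Im ?z)\<^sup>2 = 1" using cmod_power2[of ?z] by simp
    then show ?thesis by (simp add: cmod_power2 power2_diff)
  qed
  ultimately have "trig_poly 1 4 (\<lambda>\<theta> :: 'a torus. (cmod (torus_char (axis j 1) \<theta> - 1))\<^sup>2)"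
    by simp
  from trig_poly_mult[OF trig_poly_jackson this] show ?thesis by blast
qed

text \<open>
  In the coordinate \<open>j\<close> the weight cancels one of the two Fejer factors at the cost of a factor \<open>4\<close>,
  which replaces an integral of size at least \<open>R\<^sup>3 / 128\<close> by one equal to \<open>R\<close>. The other coordinates are
  unaffected, hence the quotient \<open>4 R / (R\<^sup>3 / 128)\<close>.
\<close>

lemma jackson_moment_le:
  fixes j :: "'d::finite"
  assumes R: "R \<ge> 1"
  shows "(\<integral>\<theta>. jackson R \<theta> * (cmod (torus_char (axis j 1) \<theta> - 1))\<^sup>2 \<partial>haar)
     \<le> 512 / real R ^ 2 * (\<integral>\<theta>. jackson R \<theta> \<partial>(haar :: 'd torus measure))"
proof -
  let ?g = "\<lambda>\<theta>. \<Prod>i\<in>UNIV. if i = j then fejer R i \<theta> else (fejer R i \<theta>)\<^sup>2"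
  let ?J = "dirichlet_mass R"
  have split: "(\<Prod>i\<in>UNIV. if i = j then a i else b i) = a j * (\<Prod>i\<in>UNIV - {j}. b i)" for a b :: "'d \<Rightarrow> real"
  proof -
    have "(\<Prod>i\<in>UNIV - {j}. if i = j then a i else b i) = (\<Prod>i\<in>UNIV - {j}. b i)"
      by (rule prod.cong) auto
    then show ?thesis by (subst prod.remove[of _ j]) auto
  qed
  have "trig_poly (\<Sum>i\<in>UNIV. if i = j then real R else real R + real R)
     (\<Prod>i\<in>UNIV. if i = j then real R ^ 2 else real R ^ 2 * real R ^ 2) ?g"
    using trig_poly_fejer_sq[of R] by (intro trig_poly_prod) (auto simp: trig_poly_fejer)
  note g = this
  have "(\<integral>\<theta>. jackson R \<theta> * (cmod (torus_char (axis j 1) \<theta> - 1))\<^sup>2 \<partial>haar) \<le> (\<integral>\<theta>. 4 * ?g \<theta> \<partial>haar)"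
  proof (rule integral_mono)
    show "integrable haar (\<lambda>\<theta>. jackson R \<theta> * (cmod (torus_char (axis j 1) \<theta> - 1))\<^sup>2)"
      using trig_poly_moment integrable_trig_poly by blast
    show "integrable haar (\<lambda>\<theta>. 4 * ?g \<theta>)"
      by (intro integrable_mult_right integrable_trig_poly[OF g])
    fix \<theta> :: "'d torus"
    let ?P = "\<Prod>i\<in>UNIV - {j}. (fejer R i \<theta>)\<^sup>2"
    have P: "0 \<le> fejer R j \<theta> * ?P" by (intro mult_nonneg_nonneg prod_nonneg fejer_nonneg) auto
    have "jackson R \<theta> = (fejer R j \<theta>)\<^sup>2 * ?P"
      unfolding jackson_def by (rule prod.remove) auto
    then have "jackson R \<theta> * (cmod (torus_char (axis j 1) \<theta> - 1))\<^sup>2 =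
        ((cmod (torus_char (axis j 1) \<theta> - 1))\<^sup>2 * fejer R j \<theta>) * (fejer R j \<theta> * ?P)"
      by (simp add: power2_eq_square mult_ac)
    also have "\<dots> \<le> 4 * (fejer R j \<theta> * ?P)"
      by (rule mult_right_mono[OF cmod_char_minus_1_mult_fejer P])
    finally show "jackson R \<theta> * (cmod (torus_char (axis j 1) \<theta> - 1))\<^sup>2 \<le> 4 * ?g \<theta>"
      by (simp only: split)
  qed
  also have "\<dots> = 4 * (\<integral>\<theta>. ?g \<theta> \<partial>haar)" by simp
  also have "(\<integral>\<theta>. ?g \<theta> \<partial>haar) =
      (\<Prod>i\<in>UNIV. LBINT t:{0..1}. if i = j then dirichlet_abs R t ^ 2 else dirichlet_abs R t ^ 4)"
  proof (rule haar_integral_prod)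
    show "continuous_on UNIV (\<lambda>t. if i = j then dirichlet_abs R t ^ 2 else dirichlet_abs R t ^ 4)" for i
      by (cases "i = j") (auto intro!: continuous_intros)
    show "?g \<in> borel_measurable borel" by (rule trig_poly_measurable[OF g])
    show "?g (torus_of x) = (\<Prod>i\<in>UNIV. if i = j then dirichlet_abs R (x $ i) ^ 2 else dirichlet_abs R (x $ i) ^ 4)" for x
      by (intro prod.cong refl) (simp add: fejer_torus_of)
  qed
  also have "\<dots> = (\<Prod>i\<in>UNIV. if i = j then real R else ?J)"
    by (intro prod.cong refl) (auto simp: unit_integral_dirichlet_sq dirichlet_mass_def)
  also have "\<dots> = real R * ?J ^ (CARD('d) - 1)"
    unfolding split by (simp add: card_Diff_singleton)
  also have "4 * (real R * ?J ^ (CARD('d) - 1)) = 512 / real R ^ 2 * (?J ^ (CARD('d) - 1) * (real R ^ 3 / 128))"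
    using R by (simp add: field_simps eval_nat_numeral)
  also have "\<dots> \<le> 512 / real R ^ 2 * (?J ^ (CARD('d) - 1) * ?J)"
  proof -
    have "0 \<le> real R ^ 3 / 128" by simp
    also note dirichlet_mass_ge[OF R]
    finally have "0 \<le> ?J" .
    then show ?thesis using dirichlet_mass_ge[OF R] by (intro mult_left_mono) auto
  qed
  also have "?J ^ (CARD('d) - 1) * ?J = ?J ^ CARD('d)"
    by (rule power_minus_mult) simp
  finally show ?thesis unfolding haar_integral_jackson .
qed

text \<open>
  With \<open>u = R * dist \<theta> y\<close> this passes from the Hoelder exponent to the second moment of the kernel.
\<close>

lemma powr_le_one_plus_square:
  fixes u \<alpha> :: real
  assumes "0 \<le> u" "0 < \<alpha>" "\<alpha> \<le> 2"
  shows "u powr \<alpha> \<le> 1 + u\<^sup>2"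
proof (cases "u \<le> 1")
  case True
  then have "u powr \<alpha> \<le> 1 powr \<alpha>" using assms by (intro powr_mono2) auto
  then show ?thesis by (simp add: add_increasing2)
next
  case False
  then have "u powr \<alpha> \<le> u powr 2" using assms by (intro powr_mono) auto
  also have "\<dots> = u\<^sup>2" using False by simp
  finally show ?thesis by simp
qed

text \<open>
  The polynomial is the convolution of \<open>\<phi>\<close> with the normalised Jackson kernel. Since the kernel has
  total mass one, the error is an average of \<open>\<phi> \<theta> - \<phi> y\<close>, which the Hoelder condition bounds by a power
  of the distance and the second moment of the kernel then bounds by \<open>R powr - \<alpha>\<close>. The
  crude lower bound \<open>128 powr - d\<close> for the mass of the kernel suffices for the coefficients, because any
  power of \<open>R\<close> is harmless against an exponentially small factor.
\<close>

theorem jackson_approximation: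
  fixes \<phi> :: "'d::finite torus \<Rightarrow> real"
  assumes \<alpha>: "0 < \<alpha>" "\<alpha> \<le> 2" and R: "R \<ge> 1"
    and \<phi>[measurable]: "\<phi> \<in> borel_measurable borel"
    and B: "\<And>\<theta>. \<bar>\<phi> \<theta>\<bar> \<le> B"
    and H: "\<And>\<theta> y. \<bar>\<phi> \<theta> - \<phi> y\<bar> \<le> H * dist \<theta> y powr \<alpha>"
  obtains p where
    "trig_poly (2 * real CARD('d) * real R) (128 ^ CARD('d) * B * real R ^ (4 * CARD('d))) p"
    "\<And>\<theta>. \<bar>\<phi> \<theta> - p \<theta>\<bar> \<le> (1 + 512 * real CARD('d) ^ 2) * H * real R powr - \<alpha>"
proof
  let ?d = "real CARD('d)"
  let ?W = "jackson R :: 'd torus \<Rightarrow> real"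
  let ?u = "\<lambda>j \<theta>. (cmod (torus_char (axis j 1) \<theta> - 1))\<^sup>2 :: real"
  define Z where "Z = (\<integral>\<theta>. ?W \<theta> \<partial>haar)"
  define p where "p \<theta> = inverse Z * (\<integral>y. \<phi> y * ?W (\<theta> - y) \<partial>haar)" for \<theta>
  have B0: "0 \<le> B" using B[of 0] by linarith
  have R1: "real R > 0" using R by simp
  have "(1 :: real) \<le> real R ^ 3" using R by simp
  then have "1 / 128 \<le> dirichlet_mass R" using dirichlet_mass_ge[OF R] by linarith
  then have Zge: "(1 / 128) ^ CARD('d) \<le> Z"
    unfolding Z_def haar_integral_jackson by (intro power_mono) auto
  then have Zpos: "Z > 0" by (rule less_le_trans[rotated]) simp
  have Zinv: "inverse Z \<le> 128 ^ CARD('d)"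
    using le_imp_inverse_le[OF Zge] by (simp add: power_one_over field_simps)
  have "trig_poly (2 * ?d * real R) (\<bar>inverse Z\<bar> * (B * real R ^ (4 * CARD('d)))) p"
    unfolding p_def by (intro trig_poly_scale trig_poly_convolution trig_poly_jackson \<phi> B)
  moreover have "\<bar>inverse Z\<bar> * (B * real R ^ (4 * CARD('d))) \<le> 128 ^ CARD('d) * B * real R ^ (4 * CARD('d))"
    using mult_right_mono[OF Zinv, of "B * real R ^ (4 * CARD('d))"] B0 Zpos by (simp add: mult.assoc)
  ultimately show "trig_poly (2 * ?d * real R) (128 ^ CARD('d) * B * real R ^ (4 * CARD('d))) p"
    by (metis trig_poly_mono order_refl)
  fix \<theta>
  obtain x y :: "'d torus" where "dist x y > 0"
  proof -
    obtain x y :: "'d torus" where "x \<noteq> y" using torus_nontrivial by blast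
    then show ?thesis using that by simp
  qed
  then have H0: "0 \<le> H"
    using order_trans[OF abs_ge_zero H[of x y]] by (simp add: zero_le_mult_iff)
  have intW: "integrable haar (\<lambda>y. ?W (\<theta> - y))"
    by (rule integrable_trig_poly_diff[OF trig_poly_jackson])
  have intWu: "integrable haar (\<lambda>y. ?W (\<theta> - y) * ?u j (\<theta> - y))" for j
    using trig_poly_moment integrable_trig_poly_diff[where f="\<lambda>\<theta>. ?W \<theta> * ?u j \<theta>"] by blast
  have int\<phi>W: "integrable haar (\<lambda>y. \<phi> y * ?W (\<theta> - y))"
    using B by (intro integrable_bounded_mult_left[OF intW]) auto
  have ZW: "(\<integral>y. ?W (\<theta> - y) \<partial>haar) = Z"
    unfolding Z_def by (rule haar_integral_trig_poly_diff[OF trig_poly_jackson])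
  have M: "(\<integral>y. ?W (\<theta> - y) * ?u j (\<theta> - y) \<partial>haar) \<le> 512 / real R ^ 2 * Z" for j
  proof -
    obtain S N where "trig_poly S N (\<lambda>\<theta>. ?W \<theta> * ?u j \<theta>)" using trig_poly_moment by blast
    from haar_integral_trig_poly_diff[OF this] jackson_moment_le[OF R] show ?thesis
      by (simp add: Z_def)
  qed
  have pointwise: "\<bar>\<phi> \<theta> - \<phi> y\<bar> \<le> H * real R powr - \<alpha> * (1 + real R ^ 2 * (?d * (\<Sum>j\<in>UNIV. ?u j (\<theta> - y))))" for y
  proof -
    have "(dist \<theta> y)\<^sup>2 \<le> (\<Sum>j\<in>UNIV. cmod (torus_char (axis j 1) (\<theta> - y) - 1))\<^sup>2"
      by (intro power_mono dist_torus_le_sum_char) simp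
    also have "\<dots> \<le> ?d * (\<Sum>j\<in>UNIV. ?u j (\<theta> - y))"
      using sum_squared_le_sum_of_squares[of "\<lambda>j. cmod (torus_char (axis j 1) (\<theta> - y) - 1)" "UNIV :: 'd set"]
      by (simp add: mult.commute)
    finally have d2: "(dist \<theta> y)\<^sup>2 \<le> ?d * (\<Sum>j\<in>UNIV. ?u j (\<theta> - y))" .
    have "dist \<theta> y powr \<alpha> = real R powr - \<alpha> * (real R * dist \<theta> y) powr \<alpha>"
      using R1 by (simp add: powr_mult powr_minus)
    also have "\<dots> \<le> real R powr - \<alpha> * (1 + (real R * dist \<theta> y)\<^sup>2)"
      using \<alpha> by (intro mult_left_mono powr_le_one_plus_square) auto
    also have "\<dots> \<le> real R powr - \<alpha> * (1 + real R ^ 2 * (?d * (\<Sum>j\<in>UNIV. ?u j (\<theta> - y))))"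
      unfolding power_mult_distrib by (intro mult_left_mono add_mono d2) auto
    finally show ?thesis
      using H[of \<theta> y] H0 mult_left_mono[of "dist \<theta> y powr \<alpha>" _ H] by (force simp: mult.assoc)
  qed
  have "Z * (\<phi> \<theta> - p \<theta>) = (\<integral>y. (\<phi> \<theta> - \<phi> y) * ?W (\<theta> - y) \<partial>haar)"
    unfolding left_diff_distrib p_def using Zpos intW int\<phi>W ZW
    by (simp add: right_diff_distrib)
  then have "Z * \<bar>\<phi> \<theta> - p \<theta>\<bar> = \<bar>\<integral>y. (\<phi> \<theta> - \<phi> y) * ?W (\<theta> - y) \<partial>haar\<bar>"
    using Zpos by (metis abs_mult abs_of_pos)
  also have "\<dots> \<le> (\<integral>y. \<bar>(\<phi> \<theta> - \<phi> y) * ?W (\<theta> - y)\<bar> \<partial>haar)"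
    by (rule integral_abs_bound)
  also have "\<dots> \<le> (\<integral>y. H * real R powr - \<alpha> * (?W (\<theta> - y) + real R ^ 2 * (?d * (\<Sum>j\<in>UNIV. ?W (\<theta> - y) * ?u j (\<theta> - y)))) \<partial>haar)"
  proof (rule integral_mono)
    have "integrable haar (\<lambda>y. \<phi> \<theta> * ?W (\<theta> - y) - \<phi> y * ?W (\<theta> - y))"
      by (intro Bochner_Integration.integrable_diff integrable_mult_right intW int\<phi>W)
    then show "integrable haar (\<lambda>y. \<bar>(\<phi> \<theta> - \<phi> y) * ?W (\<theta> - y)\<bar>)"
      by (simp add: left_diff_distrib)
    show "integrable haar (\<lambda>y. H * real R powr - \<alpha> * (?W (\<theta> - y) + real R ^ 2 * (?d * (\<Sum>j\<in>UNIV. ?W (\<theta> - y) * ?u j (\<theta> - y)))))"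
      by (intro integrable_mult_right Bochner_Integration.integrable_add
          Bochner_Integration.integrable_sum intW intWu)
    fix y
    have "\<bar>(\<phi> \<theta> - \<phi> y) * ?W (\<theta> - y)\<bar> = \<bar>\<phi> \<theta> - \<phi> y\<bar> * ?W (\<theta> - y)"
      by (simp add: abs_mult jackson_nonneg)
    also have "\<dots> \<le> H * real R powr - \<alpha> * (1 + real R ^ 2 * (?d * (\<Sum>j\<in>UNIV. ?u j (\<theta> - y)))) * ?W (\<theta> - y)"
      by (rule mult_right_mono[OF pointwise jackson_nonneg])
    also have "\<dots> = H * real R powr - \<alpha> * (?W (\<theta> - y) + real R ^ 2 * (?d * (\<Sum>j\<in>UNIV. ?W (\<theta> - y) * ?u j (\<theta> - y))))"
      by (simp add: sum_distrib_left distrib_left distrib_right sum_distrib_right mult_ac)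
    finally show "\<bar>(\<phi> \<theta> - \<phi> y) * ?W (\<theta> - y)\<bar> \<le> H * real R powr - \<alpha> * (?W (\<theta> - y) + real R ^ 2 * (?d * (\<Sum>j\<in>UNIV. ?W (\<theta> - y) * ?u j (\<theta> - y))))" .
  qed
  also have "\<dots> = H * real R powr - \<alpha> * (Z + real R ^ 2 * (?d * (\<Sum>j\<in>UNIV. \<integral>y. ?W (\<theta> - y) * ?u j (\<theta> - y) \<partial>haar)))"
    using intW intWu by (simp add: ZW)
  also have "\<dots> \<le> H * real R powr - \<alpha> * (Z + real R ^ 2 * (?d * (\<Sum>j\<in>(UNIV :: 'd set). 512 / real R ^ 2 * Z)))"
    using H0 by (intro mult_left_mono add_mono sum_mono M) auto
  also have "\<dots> = Z * ((1 + 512 * ?d ^ 2) * H * real R powr - \<alpha>)"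
    using R1 by (simp add: field_simps power2_eq_square)
  finally show "\<bar>\<phi> \<theta> - p \<theta>\<bar> \<le> (1 + 512 * ?d ^ 2) * H * real R powr - \<alpha>"
    using Zpos by simp
qed

section \<open>The Markov operator and its powers\<close>

locale torus_walk = prob_space \<mu> for \<mu> :: "'d::finite torus measure" +
  assumes sets_eq_borel: "sets \<mu> = sets borel"
begin

declare sets_eq_borel [simp, measurable_cong]

lemma space_eq_UNIV [simp]: "space \<mu> = UNIV"
  using sets_eq_imp_space_eq[OF sets_eq_borel] by simp

lemma integrable_translate:
  assumes [measurable]: "f \<in> borel_measurable borel" and "\<And>\<theta>. \<bar>f \<theta>\<bar> \<le> (B :: real)"
  shows "integrable \<mu> (\<lambda>\<omega>. f (\<theta> + \<omega>))"
  using assms by (intro integrable_const_bound[of _ B]) auto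

lemma markov_measurable [measurable]:
  assumes [measurable]: "f \<in> borel_measurable borel"
  shows "markov \<mu> f \<in> borel_measurable borel"
  unfolding markov_def[abs_def] by measurable

lemma markov_bound:
  assumes "f \<in> borel_measurable borel" "\<And>\<theta>. \<bar>f \<theta>\<bar> \<le> B"
  shows "\<bar>markov \<mu> f \<theta>\<bar> \<le> B"
  using norm_expectation_le[OF integrable_translate[OF assms, of \<theta>], of B] assms(2)
  by (simp add: markov_def)

lemma markov_add:
  assumes "f \<in> borel_measurable borel" "\<And>\<theta>. \<bar>f \<theta>\<bar> \<le> B"
    and "g \<in> borel_measurable borel" "\<And>\<theta>. \<bar>g \<theta>\<bar> \<le> B'"
  shows "markov \<mu> (\<lambda>\<theta>. f \<theta> + g \<theta>) = (\<lambda>\<theta>. markov \<mu> f \<theta> + markov \<mu> g \<theta>)"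
  using integrable_translate[OF assms(1,2)] integrable_translate[OF assms(3,4)]
  by (simp add: markov_def fun_eq_iff)

lemma markov_pow_measurable [measurable]:
  "f \<in> borel_measurable borel \<Longrightarrow> (markov \<mu> ^^ n) f \<in> borel_measurable borel"
  by (induction n) auto

lemma markov_pow_bound:
  assumes "f \<in> borel_measurable borel" "\<And>\<theta>. \<bar>f \<theta>\<bar> \<le> B"
  shows "\<bar>(markov \<mu> ^^ n) f \<theta>\<bar> \<le> B"
  using assms
  by (induction n arbitrary: \<theta>) (auto intro!: markov_bound)

lemma markov_pow_add:
  assumes f: "f \<in> borel_measurable borel" "\<And>\<theta>. \<bar>f \<theta>\<bar> \<le> B"
    and g: "g \<in> borel_measurable borel" "\<And>\<theta>. \<bar>g \<theta>\<bar> \<le> B'"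
  shows "(markov \<mu> ^^ n) (\<lambda>\<theta>. f \<theta> + g \<theta>) = (\<lambda>\<theta>. (markov \<mu> ^^ n) f \<theta> + (markov \<mu> ^^ n) g \<theta>)"
proof (induction n)
  case (Suc n)
  show ?case
    using markov_add[OF markov_pow_measurable[OF f(1)] markov_pow_bound[OF f]
        markov_pow_measurable[OF g(1)] markov_pow_bound[OF g], of n n]
    by (simp add: Suc)
qed simp

text \<open>
  Characters turn the translation inside the operator into multiplication, so waves are
  eigenfunctions.
\<close>

lemma markov_char: "markov \<mu> (\<lambda>\<theta>. Re (c * torus_char k \<theta>)) = (\<lambda>\<theta>. Re (c * fourier_coeff \<mu> k * torus_char k \<theta>))"
proof
  fix \<theta>
  have int: "integrable \<mu> (torus_char k)"
    by (rule integrable_const_bound[of _ 1]) auto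
  have "markov \<mu> (\<lambda>\<theta>. Re (c * torus_char k \<theta>)) \<theta> = (\<integral>\<omega>. Re (c * torus_char k \<theta> * torus_char k \<omega>) \<partial>\<mu>)"
    by (simp add: markov_def torus_char_add mult.assoc)
  also have "\<dots> = Re (\<integral>\<omega>. c * torus_char k \<theta> * torus_char k \<omega> \<partial>\<mu>)"
    by (rule integral_Re) (intro integrable_mult_right int)
  also have "\<dots> = Re (c * fourier_coeff \<mu> k * torus_char k \<theta>)"
    by (simp add: fourier_coeff_def mult_ac)
  finally show "markov \<mu> (\<lambda>\<theta>. Re (c * torus_char k \<theta>)) \<theta> = Re (c * fourier_coeff \<mu> k * torus_char k \<theta>)" .
qed

lemma markov_pow_char:
  "(markov \<mu> ^^ n) (\<lambda>\<theta>. Re (c * torus_char k \<theta>)) = (\<lambda>\<theta>. Re (c * fourier_coeff \<mu> k ^ n * torus_char k \<theta>))"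
proof (induction n)
  case (Suc n)
  show ?case
    using markov_char[of "c * fourier_coeff \<mu> k ^ n" k]
    by (simp only: funpow.simps comp_apply Suc power_Suc2 mult.assoc)
qed simp

lemma fourier_coeff_0: "fourier_coeff \<mu> 0 = 1"
  using prob_space by (simp add: fourier_coeff_def)

text \<open>
  The constant wave is fixed and gives the mean, every other wave is damped by the \<open>n\<close>-th power of a
  Fourier coefficient, and the coefficients add up to at most \<open>M\<close>.
\<close>

lemma markov_pow_trig_poly:
  assumes "trig_poly R M f"
    and \<rho>: "\<And>k. k \<noteq> 0 \<Longrightarrow> (\<And>j. \<bar>real_of_int (k $ j)\<bar> \<le> R) \<Longrightarrow> cmod (fourier_coeff \<mu> k) \<le> \<rho>"
    and "0 \<le> \<rho>"
  shows "\<bar>(markov \<mu> ^^ n) f \<theta> - (\<integral>y. f y \<partial>haar)\<bar> \<le> M * \<rho> ^ n"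
  using assms(1)
proof (induction rule: trig_poly.induct)
  case (wave k c M)
  have "(\<integral>y. Re (c * torus_char k y) \<partial>haar) = Re (\<integral>y. c * torus_char k y \<partial>haar)"
    by (rule integral_Re) (intro integrable_mult_right integrable_torus_char)
  also have "\<dots> = Re (c * (if k = 0 then 1 else 0))"
    by (simp add: haar_integral_char)
  finally have int: "(\<integral>y. Re (c * torus_char k y) \<partial>haar) = Re (c * (if k = 0 then 1 else 0))" .
  have M0: "0 \<le> M" using wave(2) norm_ge_zero order_trans by blast
  show ?case
  proof (cases "k = 0")
    case True
    then show ?thesis unfolding int markov_pow_char using M0 \<open>0 \<le> \<rho>\<close>
      by (simp add: fourier_coeff_0)
  next
    case False
    have "\<bar>Re (c * fourier_coeff \<mu> k ^ n * torus_char k \<theta>)\<bar> \<le> cmod (c * fourier_coeff \<mu> k ^ n * torus_char k \<theta>)"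
      by (rule abs_Re_le_cmod)
    also have "\<dots> = cmod c * cmod (fourier_coeff \<mu> k) ^ n"
      by (simp add: norm_mult norm_power)
    also have "\<dots> \<le> M * \<rho> ^ n"
      using wave M0 False by (intro mult_mono power_mono \<rho>) auto
    finally show ?thesis unfolding int markov_pow_char using False by simp
  qed
next
  case (add M f M' g)
  have "(markov \<mu> ^^ n) (\<lambda>\<theta>. f \<theta> + g \<theta>) \<theta> = (markov \<mu> ^^ n) f \<theta> + (markov \<mu> ^^ n) g \<theta>"
    using markov_pow_add[OF trig_poly_measurable[OF add.hyps(1)] trig_poly_bound[OF add.hyps(1)]
        trig_poly_measurable[OF add.hyps(2)] trig_poly_bound[OF add.hyps(2)]] by simp
  moreover have "(\<integral>y. f y + g y \<partial>haar) = (\<integral>y. f y \<partial>haar) + (\<integral>y. g y \<partial>haar)"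
    using add.hyps by (intro Bochner_Integration.integral_add integrable_trig_poly)
  ultimately show ?case using add.IH by (simp add: distrib_right)
qed

lemma markov_pow_near:
  assumes f: "f \<in> borel_measurable borel" and g: "g \<in> borel_measurable borel" "\<And>\<theta>. \<bar>g \<theta>\<bar> \<le> B"
    and fg: "\<And>\<theta>. \<bar>f \<theta> - g \<theta>\<bar> \<le> \<delta>"
  shows "\<bar>(markov \<mu> ^^ n) f \<theta> - (markov \<mu> ^^ n) g \<theta>\<bar> \<le> \<delta>"
proof -
  have d: "(\<lambda>\<theta>. f \<theta> - g \<theta>) \<in> borel_measurable borel" using f g(1) by measurable
  have "(markov \<mu> ^^ n) (\<lambda>\<theta>. (f \<theta> - g \<theta>) + g \<theta>) \<theta> = (markov \<mu> ^^ n) (\<lambda>\<theta>. f \<theta> - g \<theta>) \<theta> + (markov \<mu> ^^ n) g \<theta>"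
    using markov_pow_add[OF d fg g] by simp
  with markov_pow_bound[OF d fg, of n \<theta>] show ?thesis by simp
qed

end

lemma haar_integral_near:
  assumes f: "integrable haar f" and g: "integrable haar g"
    and fg: "\<And>\<theta> :: 'd::finite torus. \<bar>f \<theta> - g \<theta>\<bar> \<le> (\<delta> :: real)"
  shows "\<bar>(\<integral>y. f y \<partial>haar) - (\<integral>y. g y \<partial>haar)\<bar> \<le> \<delta>"
  using haar.norm_expectation_le[OF Bochner_Integration.integrable_diff[OF f g], of \<delta>] fg f g by simp

text \<open>
  Every norm on the lattice is dominated by the maximum norm, as one sees by expanding \<open>k\<close> in unit
  vectors. This is how the Diophantine condition for \<open>N\<close> is applied to all frequencies in a cube.
\<close>

lemma norm_le_max_freq:
  fixes N :: "int ^ 'd::finite \<Rightarrow> real"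
  assumes N: "is_norm N"
  obtains K where "0 < K" "\<forall>R k. (\<forall>j. \<bar>real_of_int (k $ j)\<bar> \<le> R) \<longrightarrow> N k \<le> K * R"
proof (rule that, safe)
  let ?S = "\<Sum>j\<in>UNIV. N (axis j 1)"
  have nonneg: "0 \<le> N k" and scale: "N (a *s k) = \<bar>of_int a\<bar> * N k" and tri: "N (k + l) \<le> N k + N l"
    and zero: "N k = 0 \<longleftrightarrow> k = 0" for k l a using N by (auto simp: is_norm_def)
  show "0 < 1 + ?S" using sum_nonneg[of UNIV "\<lambda>j. N (axis j 1)"] nonneg by (simp add: add_pos_nonneg)
  fix R and k :: "int ^ 'd" assume "\<forall>j. \<bar>real_of_int (k $ j)\<bar> \<le> R"
  then have k: "\<bar>real_of_int (k $ j)\<bar> \<le> R" for j by blast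
  have R: "0 \<le> R" using k[of undefined] by linarith
  have N0: "N 0 = 0" using zero by blast
  have sum: "N (\<Sum>j\<in>A. f j) \<le> (\<Sum>j\<in>A. N (f j))" if "finite A" for A :: "'d set" and f
    using that by (induction) (auto simp: N0 intro: order_trans[OF tri])
  have "k = (\<Sum>j\<in>UNIV. (k $ j) *s axis j 1)"
    by (simp add: vec_eq_iff axis_def if_distrib cong: if_cong)
  then have "N k \<le> (\<Sum>j\<in>UNIV. N ((k $ j) *s axis j 1))" using sum by (metis finite)
  also have "\<dots> \<le> (\<Sum>j\<in>UNIV. R * N (axis j 1))"
    unfolding scale by (intro sum_mono mult_right_mono nonneg k)
  also have "\<dots> = R * ?S" by (rule sum_distrib_left[symmetric])
  also have "\<dots> \<le> (1 + ?S) * R" using R by (simp add: algebra_simps)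
  finally show "N k \<le> (1 + ?S) * R" .
qed

text \<open>
  The suprema in the definition of the Hoelder norm say something about \<open>\<phi>\<close> only if they are taken over
  nonempty sets that are bounded above: the torus has more than one point and finite diameter.
\<close>

lemma holder_space_bounds:
  fixes \<phi> :: "'a::finite torus \<Rightarrow> real" and \<theta> \<theta>' :: "'a torus"
  assumes "\<phi> \<in> holder_space \<alpha>" "0 < \<alpha>"
  shows "\<phi> \<in> borel_measurable borel"
    and "\<bar>\<phi> \<theta>\<bar> \<le> holder_norm \<alpha> \<phi>"
    and "\<bar>\<phi> \<theta> - \<phi> \<theta>'\<bar> \<le> holder_norm \<alpha> \<phi> * dist \<theta> \<theta>' powr \<alpha>"
proof -
  obtain K where K: "\<And>\<theta> \<theta>'. \<bar>\<phi> \<theta> - \<phi> \<theta>'\<bar> \<le> K * dist \<theta> \<theta>' powr \<alpha>"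
    using assms by (auto simp: holder_space_def)
  have diam: "dist a b \<le> (2 :: real) * CARD('a)" for a b :: "'a torus"
  proof -
    have "dist a b \<le> (\<Sum>j\<in>(UNIV :: 'a set). cmod (torus_char (axis j 1) (a - b) - 1))"
      by (rule dist_torus_le_sum_char)
    also have "\<dots> \<le> (\<Sum>j\<in>(UNIV :: 'a set). 2)"
    proof (rule sum_mono)
      fix j :: 'a
      show "cmod (torus_char (axis j 1) (a - b) - 1) \<le> 2"
        using norm_triangle_ineq4[of "torus_char (axis j 1) (a - b)" 1] by simp
    qed
    finally show ?thesis by simp
  qed
  have "continuous_on UNIV \<phi>"
    unfolding continuous_on_def
  proof
    fix \<theta> :: "'a torus"
    have "((\<lambda>x. dist x \<theta>) \<longlongrightarrow> 0) (at \<theta>)"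
      using tendsto_ident_at by (rule tendsto_dist_iff[THEN iffD1])
    then have "((\<lambda>x. dist x \<theta> powr \<alpha>) \<longlongrightarrow> 0) (at \<theta>)"
      using assms(2) by (intro tendsto_zero_powrI[where b=\<alpha>]) auto
    then have "((\<lambda>x. K * dist x \<theta> powr \<alpha>) \<longlongrightarrow> K * 0) (at \<theta>)"
      by (intro tendsto_intros)
    then show "(\<phi> \<longlongrightarrow> \<phi> \<theta>) (at \<theta> within UNIV)"
      by (intro LIM_zero_cancel[of \<phi>] Lim_null_comparison[of "\<lambda>x. \<phi> x - \<phi> \<theta>"]) (auto simp: K)
  qed
  then show "\<phi> \<in> borel_measurable borel" by (rule borel_measurable_continuous_onI)
  let ?S = "{\<bar>\<phi> \<theta> - \<phi> \<theta>'\<bar> / dist \<theta> \<theta>' powr \<alpha> | \<theta> \<theta>'. \<theta> \<noteq> \<theta>'}"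
  have bdd: "bdd_above ?S"
    by (rule bdd_aboveI[of _ K]) (auto simp: pos_divide_le_eq K)
  have quot: "\<bar>\<phi> \<theta> - \<phi> \<theta>'\<bar> / dist \<theta> \<theta>' powr \<alpha> \<le> Sup ?S" if "\<theta> \<noteq> \<theta>'" for \<theta> \<theta>'
    using that by (intro cSup_upper[OF _ bdd]) auto
  have S0: "0 \<le> Sup ?S"
  proof -
    obtain a b :: "'a torus" where "a \<noteq> b" using torus_nontrivial by blast
    from order_trans[OF _ quot[OF this]] show ?thesis by simp
  qed
  have "\<bar>\<phi> \<theta>\<bar> \<le> \<bar>\<phi> 0\<bar> + \<bar>K\<bar> * (2 * CARD('a)) powr \<alpha>" for \<theta>
  proof -
    have "\<bar>\<phi> \<theta> - \<phi> 0\<bar> \<le> \<bar>K\<bar> * dist \<theta> 0 powr \<alpha>"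
      using K[of \<theta> 0] by (rule order_trans) (simp add: mult_right_mono)
    also have "\<dots> \<le> \<bar>K\<bar> * (2 * CARD('a)) powr \<alpha>"
      using diam[of \<theta> 0] assms(2) by (intro mult_left_mono powr_mono2) auto
    finally show ?thesis by linarith
  qed
  then have bdd': "bdd_above (range (\<lambda>\<theta>. \<bar>\<phi> \<theta>\<bar>))"
    by (auto intro!: bdd_aboveI)
  have sup: "\<bar>\<phi> \<theta>\<bar> \<le> sup_norm \<phi>" for \<theta>
    unfolding sup_norm_def by (rule cSUP_upper[OF UNIV_I bdd'])
  then show "\<bar>\<phi> \<theta>\<bar> \<le> holder_norm \<alpha> \<phi>"
    using S0 by (simp add: holder_norm_def add_increasing2)
  have "0 \<le> sup_norm \<phi>" using sup[of 0] by linarith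
  then have le: "Sup ?S \<le> holder_norm \<alpha> \<phi>" by (simp add: holder_norm_def)
  show "\<bar>\<phi> \<theta> - \<phi> \<theta>'\<bar> \<le> holder_norm \<alpha> \<phi> * dist \<theta> \<theta>' powr \<alpha>"
  proof (cases "\<theta> = \<theta>'")
    case False
    with order_trans[OF quot le] show ?thesis by (simp add: pos_divide_le_eq)
  qed simp
qed

text \<open>
  The function is replaced by its Jackson approximation of degree proportional to \<open>R\<close>; this costs the
  approximation error twice, once under the iterated operator, which does not increase the sup norm, and
  once in the mean. The bound depends on the step distribution only through \<open>\<gamma>\<close> and \<open>\<tau>\<close>, and
  on \<open>\<phi>\<close> only through its norm.
\<close>

theorem markov_pow_error:
  fixes N :: "int ^ 'd::finite \<Rightarrow> real" and \<mu> :: "'d torus measure"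
  assumes N: "is_norm N" and K: "0 < K" "\<forall>R k. (\<forall>j. \<bar>real_of_int (k $ j)\<bar> \<le> R) \<longrightarrow> N k \<le> K * R"
    and \<alpha>: "0 < \<alpha>" "\<alpha> \<le> 1" and g: "0 < \<gamma>" "0 < \<tau>"
    and \<mu>: "\<mu> \<in> Prob" "mixing_DC N \<gamma> \<tau> \<mu>"
    and \<phi>: "\<phi> \<in> holder_space \<alpha>" and R: "R \<ge> 1"
  shows "\<bar>(markov \<mu> ^^ n) \<phi> \<theta> - (\<integral>y. \<phi> y \<partial>haar)\<bar> \<le>
    (2 * (1 + 512 * real CARD('d) ^ 2) * real R powr - \<alpha> +
      128 ^ CARD('d) * real R ^ (4 * CARD('d)) *
        exp (- (\<gamma> / (2 * K * real CARD('d) * real R) powr \<tau>) * real n)) * holder_norm \<alpha> \<phi>"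
proof -
  interpret prob_space \<mu> using \<mu> by (simp add: Prob_def)
  interpret torus_walk \<mu> by unfold_locales (use \<mu> in \<open>simp add: Prob_def\<close>)
  let ?d = "real CARD('d)"
  let ?D = "128 ^ CARD('d) :: real"
  let ?K = "2 * K * ?d * real R"
  let ?L = "holder_norm \<alpha> \<phi>"
  note h = holder_space_bounds[OF \<phi> \<alpha>(1)]
  let ?\<delta> = "(1 + 512 * ?d ^ 2) * ?L * real R powr - \<alpha>"
  let ?\<rho> = "exp (- (\<gamma> / ?K powr \<tau>))"
  have \<alpha>2: "\<alpha> \<le> 2" using \<alpha>(2) by simp
  obtain p where p: "trig_poly (2 * ?d * real R) (?D * ?L * real R ^ (4 * CARD('d))) p"
    and near: "\<And>\<theta>. \<bar>\<phi> \<theta> - p \<theta>\<bar> \<le> ?\<delta>"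
    using jackson_approximation[OF \<alpha>(1) \<alpha>2 R h] by blast
  have \<rho>: "cmod (fourier_coeff \<mu> k) \<le> ?\<rho>"
    if k: "k \<noteq> 0" "\<And>j. \<bar>real_of_int (k $ j)\<bar> \<le> 2 * ?d * real R" for k
  proof -
    have "N k \<noteq> 0" "0 \<le> N k" using N k(1) unfolding is_norm_def by blast+
    then have Nk: "0 < N k" by simp
    have "N k \<le> ?K" using K(2)[rule_format, OF k(2)] by (simp add: mult_ac)
    then have "\<gamma> / ?K powr \<tau> \<le> \<gamma> / N k powr \<tau>"
      using g Nk K(1) R by (intro divide_left_mono powr_mono2 mult_pos_pos) auto
    moreover have "cmod (fourier_coeff \<mu> k) \<le> 1 - \<gamma> / N k powr \<tau>"
      using \<mu>(2) k(1) by (simp add: mixing_DC_def)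
    moreover have "1 + - (\<gamma> / ?K powr \<tau>) \<le> ?\<rho>" by (rule exp_ge_add_one_self)
    ultimately show ?thesis by linarith
  qed
  have "\<bar>(markov \<mu> ^^ n) p \<theta> - (\<integral>y. p y \<partial>haar)\<bar> \<le> ?D * ?L * real R ^ (4 * CARD('d)) * ?\<rho> ^ n"
    by (rule markov_pow_trig_poly[OF p \<rho>]) auto
  moreover have "\<bar>(markov \<mu> ^^ n) \<phi> \<theta> - (markov \<mu> ^^ n) p \<theta>\<bar> \<le> ?\<delta>"
    by (rule markov_pow_near[OF h(1) trig_poly_measurable[OF p] trig_poly_bound[OF p] near])
  moreover have "\<bar>(\<integral>y. \<phi> y \<partial>haar) - (\<integral>y. p y \<partial>haar)\<bar> \<le> ?\<delta>"
    using h by (intro haar_integral_near near integrable_trig_poly[OF p] haar.integrable_const_bound[of _ ?L]) auto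
  ultimately have "\<bar>(markov \<mu> ^^ n) \<phi> \<theta> - (\<integral>y. \<phi> y \<partial>haar)\<bar> \<le> 2 * ?\<delta> + ?D * ?L * real R ^ (4 * CARD('d)) * ?\<rho> ^ n"
    by linarith
  also have "?\<rho> ^ n = exp (- (\<gamma> / ?K powr \<tau>) * real n)"
    by (simp add: exp_of_nat_mult[symmetric] mult.commute)
  finally show ?thesis by (simp add: algebra_simps)
qed

section \<open>The power rate of mixing\<close>

lemma power_div_fact_le_exp:
  fixes y :: real
  assumes "0 \<le> y"
  shows "y ^ k / fact k \<le> exp y"
proof -
  have "(\<Sum>n\<in>{k}. y ^ n /\<^sub>R fact n) \<le> (\<Sum>n. y ^ n /\<^sub>R fact n)"
    by (rule sum_le_suminf[OF summable_exp_generic]) (use assms in auto)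
  then show ?thesis by (simp add: exp_def divide_inverse mult.commute)
qed

text \<open>
  For \<open>k \<ge> a / \<eta>\<close>, one term \<open>y ^ k / fact k\<close> of the exponential series at \<open>y = c * n powr \<eta>\<close> is at
  least a constant times \<open>n powr a\<close>.
\<close>

lemma powr_exp_decay_bounded:
  fixes a c \<eta> :: real
  assumes "0 < c" "0 < \<eta>"
  obtains M where "\<And>n :: nat. n \<ge> 1 \<Longrightarrow> real n powr a * exp (- (c * real n powr \<eta>)) \<le> M"
proof -
  define k where "k = nat \<lceil>a / \<eta>\<rceil>"
  have "a / \<eta> \<le> real k" unfolding k_def by linarith
  then have k: "a \<le> \<eta> * real k" using assms by (simp add: field_simps)
  have "real n powr a * exp (- (c * real n powr \<eta>)) \<le> fact k / c ^ k" if "n \<ge> 1" for n :: nat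
  proof -
    have pos: "0 < real n" using that by simp
    have "c ^ k * real n powr a \<le> c ^ k * real n powr (\<eta> * real k)"
      using that k assms by (intro mult_left_mono powr_mono) auto
    also have "\<dots> = (c * real n powr \<eta>) ^ k"
      using pos by (simp add: power_mult_distrib powr_powr[symmetric] powr_realpow)
    also have "\<dots> \<le> fact k * exp (c * real n powr \<eta>)"
      using power_div_fact_le_exp[of "c * real n powr \<eta>" k] assms by (simp add: field_simps)
    finally show ?thesis using assms by (simp add: exp_minus field_simps)
  qed
  then show thesis by (rule that)
qed

text \<open>
  With \<open>R\<close> close to \<open>n powr s\<close> and \<open>s = 1 / \<tau> - \<iota> / \<alpha>\<close>, the approximation error is of order
  \<open>n powr - (\<alpha> s) = n powr - (\<alpha> / \<tau> - \<iota>)\<close>, and the exponent \<open>n / R powr \<tau>\<close> of the spectral error grows like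
  \<open>n powr (1 - s \<tau>) = n powr (\<iota> \<tau> / \<alpha>)\<close>. The loss \<open>\<iota>\<close> is the price for having this last exponent
  positive.
\<close>

theorem mixing_power_rate_exists:
  fixes N :: "int ^ 'd::finite \<Rightarrow> real" and \<mu> :: "'d torus measure"
  assumes N: "is_norm N" and \<alpha>: "0 < \<alpha>" "\<alpha> \<le> 1"
    and g: "0 < \<gamma>" "0 < \<tau>" and \<mu>: "\<mu> \<in> Prob" "mixing_DC N \<gamma> \<tau> \<mu>"
    and \<iota>: "0 < \<iota>" "\<iota> < \<alpha> / \<tau>"
  shows "\<exists>C. mixing_power_rate \<mu> \<alpha> C (\<alpha> / \<tau> - \<iota>)"
proof -
  obtain K0 where K0: "0 < K0" "\<forall>R k. (\<forall>j. \<bar>real_of_int (k $ j)\<bar> \<le> R) \<longrightarrow> N k \<le> K0 * R"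
    by (rule norm_le_max_freq[OF N])
  define C D K where "C = 2 * (1 + 512 * real CARD('d) ^ 2)" and "D = (128 :: real) ^ CARD('d)"
    and "K = 2 * K0 * real CARD('d)"
  have CDK: "C > 0" "D > 0" "K > 0" using K0 by (auto simp: C_def D_def K_def add_pos_nonneg)
  note bound = markov_pow_error[OF N K0 \<alpha> g \<mu>, folded C_def D_def K_def]
  define q where "q = 4 * CARD('d)"
  define p where "p = \<alpha> / \<tau> - \<iota>"
  define s where "s = 1 / \<tau> - \<iota> / \<alpha>"
  have s: "0 < s" "\<alpha> * s = p" "0 < 1 - s * \<tau>"
    using \<alpha> g \<iota> by (auto simp: s_def p_def field_simps)
  define c where "c = \<gamma> / (K * 2) powr \<tau>"
  have c: "0 < c" using g CDK by (simp add: c_def)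
  obtain M where M: "\<And>n :: nat. n \<ge> 1 \<Longrightarrow>
      real n powr (s * real q + p) * exp (- (c * real n powr (1 - s * \<tau>))) \<le> M"
    using powr_exp_decay_bounded[OF c s(3)] by blast
  define E where "E = C + D * 2 ^ q * M"
  have "\<bar>(markov \<mu> ^^ n) \<phi> \<theta> - (\<integral>y. \<phi> y \<partial>haar)\<bar> \<le> E * (1 / real n powr p) * holder_norm \<alpha> \<phi>"
    if \<phi>: "\<phi> \<in> holder_space \<alpha>" and n: "n \<ge> 1" for \<phi> n \<theta>
  proof -
    define R where "R = nat \<lceil>real n powr s\<rceil>"
    have n0: "0 < real n" using n by simp
    have ns: "1 \<le> real n powr s" using n s by (intro ge_one_powr_ge_zero) auto
    then have R: "real n powr s \<le> real R" "real R \<le> 2 * real n powr s" "R \<ge> 1"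
      unfolding R_def by linarith+
    have L: "0 \<le> holder_norm \<alpha> \<phi>"
      using holder_space_bounds(2)[OF \<phi> \<alpha>(1), of 0] by linarith
    have "real R powr - \<alpha> \<le> (real n powr s) powr - \<alpha>"
      using R ns \<alpha> n0 by (intro powr_mono2') auto
    also have "\<dots> = 1 / real n powr p"
      using s(2) by (simp add: powr_powr powr_minus divide_inverse mult.commute)
    finally have t1: "real R powr - \<alpha> \<le> 1 / real n powr p" .
    have "(K * real R) powr \<tau> \<le> (K * 2 * real n powr s) powr \<tau>"
      using R CDK g by (intro powr_mono2) auto
    also have "\<dots> = (K * 2) powr \<tau> * real n powr (s * \<tau>)"
      using CDK by (simp add: powr_mult powr_powr)
    finally have "\<gamma> / ((K * 2) powr \<tau> * real n powr (s * \<tau>)) \<le> \<gamma> / (K * real R) powr \<tau>"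
      using g CDK R n by (intro divide_left_mono) auto
    then have "\<gamma> / ((K * 2) powr \<tau> * real n powr (s * \<tau>)) * real n \<le> \<gamma> / (K * real R) powr \<tau> * real n"
      by (rule mult_right_mono) simp
    also have "\<gamma> / ((K * 2) powr \<tau> * real n powr (s * \<tau>)) * real n = c * real n powr (1 - s * \<tau>)"
      using n0 by (simp add: c_def powr_diff)
    finally have t2: "exp (- (\<gamma> / (K * real R) powr \<tau>) * real n) \<le> exp (- (c * real n powr (1 - s * \<tau>)))"
      by simp
    have "real R ^ q \<le> (2 * real n powr s) ^ q" using R by (intro power_mono) auto
    also have "\<dots> = 2 ^ q * real n powr (s * real q)"
      using n0 by (simp add: power_mult_distrib powr_powr[symmetric] powr_realpow)
    finally have t3: "real R ^ q \<le> 2 ^ q * real n powr (s * real q)" .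
    have "real R ^ q * exp (- (\<gamma> / (K * real R) powr \<tau>) * real n)
        \<le> (2 ^ q * real n powr (s * real q)) * exp (- (c * real n powr (1 - s * \<tau>)))"
      by (intro mult_mono t2 t3) auto
    also have "\<dots> = 2 ^ q * (real n powr (s * real q + p) * exp (- (c * real n powr (1 - s * \<tau>)))) * (1 / real n powr p)"
      using n0 by (simp add: powr_add)
    also have "\<dots> \<le> 2 ^ q * M * (1 / real n powr p)"
      by (intro mult_right_mono mult_left_mono M n) auto
    finally have t4: "real R ^ q * exp (- (\<gamma> / (K * real R) powr \<tau>) * real n) \<le> 2 ^ q * M * (1 / real n powr p)" .
    have "C * real R powr - \<alpha> + D * real R ^ q * exp (- (\<gamma> / (K * real R) powr \<tau>) * real n)
       \<le> C * (1 / real n powr p) + D * (2 ^ q * M * (1 / real n powr p))"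
      unfolding mult.assoc[of D] using CDK by (intro add_mono mult_left_mono t1 t4) auto
    also have "\<dots> = E * (1 / real n powr p)" by (simp add: E_def algebra_simps)
    finally show ?thesis
      using bound[OF \<phi> R(3), of n \<theta>] L unfolding q_def[symmetric]
      by (meson mult_right_mono order_trans)
  qed
  then have "mixing_power_rate \<mu> \<alpha> E p"
    unfolding mixing_power_rate_def sup_norm_def by (auto intro!: cSUP_least)
  then show ?thesis unfolding p_def by blast
qed

section \<open>Large deviations\<close>

text \<open>
  First \<open>R\<close> is chosen to make the approximation error small, then \<open>m\<close> to make the spectral error small.
  Neither choice looks at the step distribution or at the function beyond \<open>\<gamma>\<close>, \<open>\<tau>\<close> and the norm \<open>L\<close>.
\<close>

lemma uniform_mixing_time:
  fixes N :: "int ^ 'd::finite \<Rightarrow> real"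
  assumes N: "is_norm N" and \<alpha>: "0 < \<alpha>" "\<alpha> \<le> 1" and g: "0 < \<gamma>" "0 < \<tau>" and e: "0 < \<epsilon>"
  shows "\<exists>m. \<forall>\<mu>\<in>(Prob :: 'd torus measure set). mixing_DC N \<gamma> \<tau> \<mu> \<longrightarrow>
    (\<forall>\<phi>\<in>holder_space \<alpha>. holder_norm \<alpha> \<phi> = L \<longrightarrow>
      (\<forall>\<theta>. \<bar>(markov \<mu> ^^ m) \<phi> \<theta> - (\<integral>y. \<phi> y \<partial>haar)\<bar> \<le> \<epsilon>))"
proof -
  obtain K0 where K0: "0 < K0" "\<forall>R k. (\<forall>j. \<bar>real_of_int (k $ j)\<bar> \<le> R) \<longrightarrow> N k \<le> K0 * R"
    by (rule norm_le_max_freq[OF N])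
  define C D K where "C = 2 * (1 + 512 * real CARD('d) ^ 2)" and "D = (128 :: real) ^ CARD('d)"
    and "K = 2 * K0 * real CARD('d)"
  have CDK: "C > 0" "D > 0" "K > 0" using K0 by (auto simp: C_def D_def K_def add_pos_nonneg)
  note bound = markov_pow_error[OF N K0 \<alpha> g, folded C_def D_def K_def]
  have "(\<lambda>R. C * real R powr - \<alpha> * L) \<longlonglongrightarrow> C * 0 * L"
    using \<alpha> by (intro tendsto_intros tendsto_neg_powr filterlim_real_sequentially) auto
  then have "\<forall>\<^sub>F R in sequentially. C * real R powr - \<alpha> * L < \<epsilon> / 2"
    using e by (intro order_tendstoD(2)) auto
  then have "\<forall>\<^sub>F R in sequentially. C * real R powr - \<alpha> * L < \<epsilon> / 2 \<and> R \<ge> 1"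
    using eventually_ge_at_top by (rule eventually_conj)
  then obtain R where R: "C * real R powr - \<alpha> * L < \<epsilon> / 2" "R \<ge> 1"
    using eventually_happens'[OF sequentially_bot] by blast
  let ?x = "\<gamma> / (K * real R) powr \<tau>"
  let ?A = "D * real R ^ (4 * CARD('d))"
  have x: "0 < ?x" using g CDK R by simp
  have "(\<lambda>m. ?A * exp (- ?x) ^ m * L) \<longlonglongrightarrow> ?A * 0 * L"
    by (intro tendsto_intros LIMSEQ_realpow_zero) (use x in auto)
  then have "\<forall>\<^sub>F m in sequentially. ?A * exp (- ?x) ^ m * L < \<epsilon> / 2"
    using e by (intro order_tendstoD(2)) auto
  then obtain m where m: "?A * exp (- ?x) ^ m * L < \<epsilon> / 2"
    using eventually_happens'[OF sequentially_bot] by blast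
  have ex: "exp (- ?x) ^ m = exp (- ?x * real m)"
    by (simp add: exp_of_nat_mult[symmetric] mult.commute)
  have "(C * real R powr - \<alpha> + ?A * exp (- ?x * real m)) * L \<le> \<epsilon>"
    using R(1) m unfolding ex by (simp add: distrib_right)
  note small = this
  show ?thesis
  proof (intro exI[of _ m] ballI impI allI)
    fix \<mu> :: "'d torus measure" and \<phi> :: "'d torus \<Rightarrow> real" and \<theta>
    assume "\<mu> \<in> Prob" "mixing_DC N \<gamma> \<tau> \<mu>" "\<phi> \<in> holder_space \<alpha>" and L: "holder_norm \<alpha> \<phi> = L"
    from bound[OF this(1-3) R(2), of m \<theta>] small
    show "\<bar>(markov \<mu> ^^ m) \<phi> \<theta> - (\<integral>y. \<phi> y \<partial>haar)\<bar> \<le> \<epsilon>" unfolding L by (rule order_trans)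
  qed
qed

context torus_walk
begin

text \<open>
  By Hoeffding's lemma: under \<open>\<mu>\<close>, the value after one step lies in an interval of length \<open>2 A\<close> and has
  the expectation \<open>markov \<mu> h \<theta>\<close>.
\<close>

lemma Hoeffding_markov_step:
  assumes [measurable]: "h \<in> borel_measurable borel" and A: "\<And>\<theta>. \<bar>h \<theta>\<bar> \<le> A" and t: "0 < t"
  shows "(\<integral>\<^sup>+\<omega>. ennreal (exp (t * (h (\<theta> + \<omega>) - markov \<mu> h \<theta>))) \<partial>\<mu>) \<le> ennreal (exp (t\<^sup>2 * A\<^sup>2 / 2))"
proof -
  have h: "- A \<le> h x" "h x \<le> A" for x using A[of x] by auto
  interpret H: interval_bounded_random_variable \<mu> "\<lambda>\<omega>. h (\<theta> + \<omega>)" "- A" A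
    by unfold_locales (auto simp: h)
  have "(\<integral>\<^sup>+\<omega>. ennreal (exp (t * (h (\<theta> + \<omega>) - markov \<mu> h \<theta>))) \<partial>\<mu>)
      \<le> ennreal (exp (t\<^sup>2 * (A - - A)\<^sup>2 / 8))"
    unfolding markov_def by (rule H.Hoeffdings_lemma_nn_integral[OF t])
  also have "t\<^sup>2 * (A - - A)\<^sup>2 / 8 = t\<^sup>2 * A\<^sup>2 / 2" by (simp add: power2_eq_square)
  finally show ?thesis .
qed

text \<open>
  For the walk that starts in \<open>\<theta>\<close> and has steps \<open>\<omega>\<close>, the summands are the differences between the value
  of \<open>h\<close> at time \<open>j + 1\<close> and its conditional expectation given the position at time \<open>j\<close>.
\<close>

definition martingale :: "('d torus \<Rightarrow> real) \<Rightarrow> nat \<Rightarrow> 'd torus \<Rightarrow> (nat \<Rightarrow> 'd torus) \<Rightarrow> real" where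
  "martingale h n \<theta> \<omega> = (\<Sum>j<n. h (\<theta> + (\<Sum>i<Suc j. \<omega> i)) - markov \<mu> h (\<theta> + (\<Sum>i<j. \<omega> i)))"

abbreviation path_measure :: "(nat \<Rightarrow> 'd torus) measure" where
  "path_measure \<equiv> \<Pi>\<^sub>M i\<in>UNIV. \<mu>"

lemma martingale_measurable [measurable]:
  assumes [measurable]: "h \<in> borel_measurable borel"
  shows "martingale h n \<theta> \<in> borel_measurable path_measure"
  unfolding martingale_def[abs_def] by measurable

text \<open>
  After the first step \<open>s\<close>, the walk starts afresh from \<open>\<theta> + s\<close>.
\<close>

lemma martingale_Suc_case_nat:
  "martingale h (Suc n) \<theta> (case_nat s \<omega>) = (h (\<theta> + s) - markov \<mu> h \<theta>) + martingale h n (\<theta> + s) \<omega>"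
proof -
  have "(\<Sum>i<Suc j. case_nat s \<omega> i) = s + (\<Sum>i<j. \<omega> i)" for j
    by (simp add: sum.lessThan_Suc_shift del: sum.lessThan_Suc)
  note shift = this
  show ?thesis
    unfolding martingale_def sum.lessThan_Suc_shift[of _ n] shift
    by (simp add: shift[of 0, simplified] add.assoc del: sum.lessThan_Suc)
qed

text \<open>
  The Azuma-Hoeffding induction, with the first rather than the last step split off: the path measure
  is the distribution of an independent first step followed by a path, and the induction hypothesis,
  being uniform in the starting point, bounds the inner integral over the remaining path.
\<close>

lemma martingale_exp_moment:
  assumes [measurable]: "h \<in> borel_measurable borel" and A: "\<And>\<theta>. \<bar>h \<theta>\<bar> \<le> A" and t: "0 < t"
  shows "(\<integral>\<^sup>+\<omega>. ennreal (exp (t * martingale h n \<theta> \<omega>)) \<partial>path_measure) \<le> ennreal (exp (t\<^sup>2 * A\<^sup>2 / 2)) ^ n"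
proof (induction n arbitrary: \<theta>)
  case 0
  interpret S: sequence_space \<mu> ..
  show ?case by (simp add: martingale_def S.emeasure_space_1)
next
  case (Suc n)
  interpret S: sequence_space \<mu> ..
  let ?E = "ennreal (exp (t\<^sup>2 * A\<^sup>2 / 2))"
  let ?D = "\<lambda>s. h (\<theta> + s) - markov \<mu> h \<theta>"
  have [measurable]: "(\<lambda>x. martingale h n (\<theta> + fst x) (snd x)) \<in> borel_measurable (\<mu> \<Otimes>\<^sub>M path_measure)"
    unfolding martingale_def by measurable
  have "(\<integral>\<^sup>+\<omega>. ennreal (exp (t * martingale h (Suc n) \<theta> \<omega>)) \<partial>path_measure) =
     (\<integral>\<^sup>+x. ennreal (exp (t * martingale h (Suc n) \<theta> (case x of (s, \<omega>) \<Rightarrow> case_nat s \<omega>))) \<partial>(\<mu> \<Otimes>\<^sub>M path_measure))"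
    by (subst S.PiM_iter[symmetric], subst nn_integral_distr) auto
  also have "\<dots> = (\<integral>\<^sup>+x. ennreal (exp (t * ?D (fst x))) * ennreal (exp (t * martingale h n (\<theta> + fst x) (snd x))) \<partial>(\<mu> \<Otimes>\<^sub>M path_measure))"
    by (intro nn_integral_cong)
      (simp add: case_prod_beta martingale_Suc_case_nat distrib_left exp_add ennreal_mult)
  also have "\<dots> = (\<integral>\<^sup>+s. \<integral>\<^sup>+\<omega>. ennreal (exp (t * ?D s)) * ennreal (exp (t * martingale h n (\<theta> + s) \<omega>)) \<partial>path_measure \<partial>\<mu>)"
    by (subst S.P.nn_integral_fst[symmetric]) auto
  also have "\<dots> = (\<integral>\<^sup>+s. ennreal (exp (t * ?D s)) * (\<integral>\<^sup>+\<omega>. ennreal (exp (t * martingale h n (\<theta> + s) \<omega>)) \<partial>path_measure) \<partial>\<mu>)"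
    by (intro nn_integral_cong nn_integral_cmult) measurable
  also have "\<dots> \<le> (\<integral>\<^sup>+s. ennreal (exp (t * ?D s)) * ?E ^ n \<partial>\<mu>)"
    by (intro nn_integral_mono mult_left_mono Suc.IH) auto
  also have "\<dots> = (\<integral>\<^sup>+s. ennreal (exp (t * ?D s)) \<partial>\<mu>) * ?E ^ n"
    by (rule nn_integral_multc) measurable
  also have "\<dots> \<le> ?E * ?E ^ n"
    by (intro mult_right_mono Hoeffding_markov_step A t) auto
  finally show ?case by simp
qed

text \<open>
  Chernoff's bound, with the parameter \<open>t = e / A\<^sup>2\<close> that minimises \<open>- t e + t\<^sup>2 A\<^sup>2 / 2\<close>.
\<close>

lemma martingale_tail:
  assumes h[measurable]: "h \<in> borel_measurable borel" and A: "\<And>\<theta>. \<bar>h \<theta>\<bar> \<le> A" "0 < A" and e: "0 < e"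
  shows "measure path_measure {\<omega> \<in> space path_measure. martingale h n \<theta> \<omega> \<ge> real n * e}
    \<le> exp (- (e\<^sup>2 / (2 * A\<^sup>2)) * real n)"
proof -
  interpret S: sequence_space \<mu> ..
  define t where "t = e / A\<^sup>2"
  have t: "0 < t" using e A by (simp add: t_def)
  let ?W = "\<lambda>\<omega>. martingale h n \<theta> \<omega>"
  have "emeasure path_measure {\<omega> \<in> space path_measure. ?W \<omega> \<ge> real n * e}
    \<le> ennreal (exp (- t * (real n * e))) * (\<integral>\<^sup>+\<omega>. ennreal (exp (t * ?W \<omega>)) * indicator (space path_measure) \<omega> \<partial>path_measure)"
    by (rule Chernoff_ineq_nn_integral_ge[OF t]) auto
  also have "(\<integral>\<^sup>+\<omega>. ennreal (exp (t * ?W \<omega>)) * indicator (space path_measure) \<omega> \<partial>path_measure)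
      = (\<integral>\<^sup>+\<omega>. ennreal (exp (t * ?W \<omega>)) \<partial>path_measure)"
    by (intro nn_integral_cong) simp
  also have "ennreal (exp (- t * (real n * e))) * (\<integral>\<^sup>+\<omega>. ennreal (exp (t * ?W \<omega>)) \<partial>path_measure)
      \<le> ennreal (exp (- t * (real n * e))) * ennreal (exp (t\<^sup>2 * A\<^sup>2 / 2)) ^ n"
    by (intro mult_left_mono martingale_exp_moment h A t) auto
  also have "\<dots> = ennreal (exp (- t * (real n * e) + real n * (t\<^sup>2 * A\<^sup>2 / 2)))"
    by (simp add: ennreal_power ennreal_mult[symmetric] exp_of_nat_mult[symmetric] flip: exp_add)
  also have "- t * (real n * e) + real n * (t\<^sup>2 * A\<^sup>2 / 2) = - (e\<^sup>2 / (2 * A\<^sup>2)) * real n"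
    using A(2) by (simp add: t_def field_simps power2_eq_square)
  finally show ?thesis
    by (simp add: S.emeasure_eq_measure)
qed

lemma markov_sum_pow:
  assumes "f \<in> borel_measurable borel" "\<And>\<theta>. \<bar>f \<theta>\<bar> \<le> B"
  shows "markov \<mu> (\<lambda>\<theta>. \<Sum>i<m. (markov \<mu> ^^ i) f \<theta>) = (\<lambda>\<theta>. \<Sum>i<m. (markov \<mu> ^^ Suc i) f \<theta>)"
proof (induction m)
  case 0
  show ?case by (simp add: markov_def)
next
  case (Suc m)
  have 1: "(\<lambda>\<theta>. \<Sum>i<m. (markov \<mu> ^^ i) f \<theta>) \<in> borel_measurable borel"
    using assms(1) by measurable
  have 2: "\<bar>\<Sum>i<m. (markov \<mu> ^^ i) f \<theta>\<bar> \<le> (\<Sum>i<m. B)" for \<theta>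
    by (intro order_trans[OF sum_abs] sum_mono markov_pow_bound assms)
  show ?case
    using markov_add[OF 1 2 markov_pow_measurable[OF assms(1)] markov_pow_bound[OF assms], of m]
    by (simp add: Suc fun_eq_iff)
qed

text \<open>
  Gordin's decomposition: \<open>h\<close> solves \<open>h - Q h = \<phi> - Q\<^sup>m \<phi>\<close>, and summing \<open>h - Q h\<close> along the
  path leaves the martingale and the boundary terms \<open>h (X 0)\<close> and \<open>Q h (X n)\<close>. Of the deviation
  \<open>\<epsilon> n\<close>, the defect of \<open>Q\<^sup>m \<phi>\<close> from the mean uses up at most a half and the boundary terms together
  with the extra summand \<open>j = n\<close> at most a quarter, so the martingale must exceed
  \<open>n \<epsilon> / 4\<close> in absolute value.
\<close>

lemma birkhoff_deviation:
  assumes \<phi>[measurable]: "\<phi> \<in> borel_measurable borel" and L: "\<And>\<theta>. \<bar>\<phi> \<theta>\<bar> \<le> L"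
    and m: "\<And>\<theta>. \<bar>(markov \<mu> ^^ m) \<phi> \<theta> - c\<bar> \<le> \<epsilon> / 4" and c: "\<bar>c\<bar> \<le> L"
    and e: "0 < \<epsilon>" and n: "n \<ge> 1" "(2 * real m + 1) * L \<le> real n * (\<epsilon> / 4)"
  shows "measure path_measure {\<omega> \<in> space path_measure.
      \<bar>(1 / real n) * (\<Sum>j=0..n. \<phi> (\<theta> + (\<Sum>i<j. \<omega> i))) - c\<bar> > \<epsilon>}
    \<le> 2 * exp (- (\<epsilon>\<^sup>2 / (32 * (real m * L + 1)\<^sup>2)) * real n)"
proof -
  interpret S: sequence_space \<mu> ..
  have L0: "0 \<le> L" using L[of 0] by linarith
  define h where "h \<theta> = (\<Sum>i<m. (markov \<mu> ^^ i) \<phi> \<theta>)" for \<theta>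
  have h_meas[measurable]: "h \<in> borel_measurable borel" unfolding h_def[abs_def] by measurable
  have h_le: "\<bar>h \<theta>\<bar> \<le> real m * L" for \<theta>
  proof -
    have "\<bar>h \<theta>\<bar> \<le> (\<Sum>i<m. L)" unfolding h_def
      by (intro order_trans[OF sum_abs] sum_mono markov_pow_bound \<phi> L)
    then show ?thesis by simp
  qed
  have Qh_le: "\<bar>markov \<mu> h \<theta>\<bar> \<le> real m * L" for \<theta>
    by (rule markov_bound[OF h_meas h_le])
  have Qh: "markov \<mu> h \<theta> = (\<Sum>i<m. (markov \<mu> ^^ Suc i) \<phi> \<theta>)" for \<theta>
    unfolding h_def[abs_def] using markov_sum_pow[OF \<phi> L] by metis
  \<comment> \<open>The sum of the iterates telescopes.\<close>
  have cob: "\<phi> \<theta> = h \<theta> - markov \<mu> h \<theta> + (markov \<mu> ^^ m) \<phi> \<theta>" for \<theta>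
    unfolding Qh unfolding h_def
    using sum_lessThan_telescope'[of "\<lambda>i. (markov \<mu> ^^ i) \<phi> \<theta>" m]
    by (simp add: sum_subtractf)
  \<comment> \<open>Adding \<open>1\<close> keeps the bound on \<open>h\<close> positive, as the tail estimate divides by it.\<close>
  let ?A = "real m * L + 1"
  have A: "0 < ?A" using L0 by (simp add: add_nonneg_pos)
  have hA: "\<bar>h \<theta>\<bar> \<le> ?A" "\<bar>- h \<theta>\<bar> \<le> ?A" for \<theta> using h_le[of \<theta>] by auto
  let ?e = "\<epsilon> / 4"
  let ?B = "{\<omega> \<in> space path_measure. \<bar>(1 / real n) * (\<Sum>j=0..n. \<phi> (\<theta> + (\<Sum>i<j. \<omega> i))) - c\<bar> > \<epsilon>}"
  let ?U = "\<lambda>h. {\<omega> \<in> space path_measure. martingale h n \<theta> \<omega> \<ge> real n * ?e}"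
  have neg: "martingale (\<lambda>x. - h x) n \<theta> \<omega> = - martingale h n \<theta> \<omega>" for \<omega>
    by (simp add: martingale_def markov_def sum_negf[symmetric])
  have "?B \<subseteq> ?U h \<union> ?U (\<lambda>x. - h x)"
  proof
    fix \<omega> assume B: "\<omega> \<in> ?B"
    define X where "X j = \<theta> + (\<Sum>i<j. \<omega> i)" for j
    let ?W = "martingale h n \<theta> \<omega>"
    let ?Q = "\<Sum>j=0..n. (markov \<mu> ^^ m) \<phi> (X j) - c"
    have W: "?W = (\<Sum>j<n. h (X (Suc j)) - markov \<mu> h (X j))"
      by (simp add: martingale_def X_def del: sum.lessThan_Suc)
    have "(\<Sum>j=0..n. h (X j)) = h (X 0) + (\<Sum>j<n. h (X (Suc j)))"
      by (simp add: atLeast0AtMost sum.atMost_shift)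
    moreover have "(\<Sum>j=0..n. markov \<mu> h (X j)) = (\<Sum>j<n. markov \<mu> h (X j)) + markov \<mu> h (X n)"
      by (simp add: atLeast0AtMost lessThan_Suc_atMost[symmetric])
    ultimately have tel: "(\<Sum>j=0..n. h (X j) - markov \<mu> h (X j)) = h (X 0) - markov \<mu> h (X n) + ?W"
      unfolding W by (simp add: sum_subtractf)
    have "(\<Sum>j=0..n. \<phi> (X j)) = (\<Sum>j=0..n. (h (X j) - markov \<mu> h (X j)) + ((markov \<mu> ^^ m) \<phi> (X j) - c) + c)"
      by (intro sum.cong refl) (subst cob, simp)
    also have "\<dots> = h (X 0) - markov \<mu> h (X n) + ?W + ?Q + (real n + 1) * c"
      unfolding sum.distrib tel by simp
    finally have sum: "(\<Sum>j=0..n. \<phi> (X j)) - real n * c = h (X 0) - markov \<mu> h (X n) + ?W + ?Q + c"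
      by (simp add: algebra_simps)
    have "\<bar>?Q\<bar> \<le> (\<Sum>j=0..n. \<epsilon> / 4)"
      by (intro order_trans[OF sum_abs] sum_mono m)
    then have Q: "\<bar>?Q\<bar> \<le> (real n + 1) * (\<epsilon> / 4)"
      by (simp add: add.commute)
    \<comment> \<open>The sum has \<open>n + 1\<close> terms but is divided by \<open>n\<close>.\<close>
    have "(real n + 1) * (\<epsilon> / 4) \<le> real n * (\<epsilon> / 2)"
      using n(1) e by (simp add: field_simps)
    moreover have "2 * (real m * L) + L \<le> real n * (\<epsilon> / 4)" using n(2) by (simp add: algebra_simps)
    ultimately have le: "\<bar>(\<Sum>j=0..n. \<phi> (X j)) - real n * c\<bar> \<le> \<bar>?W\<bar> + real n * (\<epsilon> / 4) + real n * (\<epsilon> / 2)"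
      unfolding sum using h_le[of "X 0"] Qh_le[of "X n"] Q c by linarith
    have "\<epsilon> < \<bar>(1 / real n) * (\<Sum>j=0..n. \<phi> (X j)) - c\<bar>" using B by (simp add: X_def)
    also have "(1 / real n) * (\<Sum>j=0..n. \<phi> (X j)) - c = ((\<Sum>j=0..n. \<phi> (X j)) - real n * c) / real n"
      using n(1) by (simp add: field_simps)
    finally have "real n * \<epsilon> < \<bar>(\<Sum>j=0..n. \<phi> (X j)) - real n * c\<bar>"
      using n(1) by (simp add: field_simps)
    with le have "real n * (\<epsilon> / 4) \<le> \<bar>?W\<bar>" by (simp add: field_simps)
    then show "\<omega> \<in> ?U h \<union> ?U (\<lambda>x. - h x)"
      using B unfolding neg by (auto simp: abs_if split: if_splits)
  qed
  then have "measure path_measure ?B \<le> measure path_measure (?U h \<union> ?U (\<lambda>x. - h x))"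
    by (rule S.P.finite_measure_mono) measurable
  also have "\<dots> \<le> measure path_measure (?U h) + measure path_measure (?U (\<lambda>x. - h x))"
    by (rule measure_Un_le) measurable
  also have "\<dots> \<le> exp (- (?e\<^sup>2 / (2 * ?A\<^sup>2)) * real n) + exp (- (?e\<^sup>2 / (2 * ?A\<^sup>2)) * real n)"
    using e by (intro add_mono martingale_tail hA A) auto
  also have "?e\<^sup>2 / (2 * ?A\<^sup>2) = \<epsilon>\<^sup>2 / (32 * ?A\<^sup>2)" by (simp add: power_divide)
  finally show ?thesis by simp
qed

end

theorem theorem1p2:
  fixes N :: "int ^ 'd::finite \<Rightarrow> real" and \<alpha> :: real
  assumes "is_norm N" and "0 < \<alpha>" and "\<alpha> \<le> 1"
  shows
    "(\<forall>\<gamma>>0. \<forall>\<tau>>0. \<forall>\<mu>\<in>(Prob :: 'd torus measure set). mixing_DC N \<gamma> \<tau> \<mu> \<longrightarrow>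
        (\<exists>C p. p > 0 \<and> mixing_power_rate \<mu> \<alpha> C p) \<and>
        (\<forall>\<iota>. 0 < \<iota> \<and> \<iota> < \<alpha> / \<tau> \<longrightarrow> (\<exists>C. mixing_power_rate \<mu> \<alpha> C (\<alpha> / \<tau> - \<iota>))))
     \<and>
     (\<exists>(c :: real \<Rightarrow> real \<Rightarrow> real \<Rightarrow> real \<Rightarrow> real) (n\<^sub>0 :: real \<Rightarrow> real \<Rightarrow> real \<Rightarrow> real \<Rightarrow> nat).
        \<forall>\<gamma>>0. \<forall>\<tau>>0. \<forall>\<mu>\<in>(Prob :: 'd torus measure set). mixing_DC N \<gamma> \<tau> \<mu> \<longrightarrow>
          (\<forall>\<phi>\<in>holder_space \<alpha>. \<forall>\<epsilon>>0.
             c \<epsilon> (holder_norm \<alpha> \<phi>) \<gamma> \<tau> > 0 \<and>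
             (\<forall>n \<ge> n\<^sub>0 \<epsilon> (holder_norm \<alpha> \<phi>) \<gamma> \<tau>. \<forall>\<theta>.
                \<P>(\<omega> in (\<Pi>\<^sub>M i\<in>(UNIV :: nat set). \<mu>).
                   \<bar>(1 / real n) * (\<Sum>j=0..n. \<phi> (\<theta> + (\<Sum>i<j. \<omega> i))) - (\<integral>\<theta>'. \<phi> \<theta>' \<partial>haar)\<bar> > \<epsilon>)
                < exp (- c \<epsilon> (holder_norm \<alpha> \<phi>) \<gamma> \<tau> * real n))))"
proof (rule conjI, goal_cases)
  case 1
  note rate = mixing_power_rate_exists[OF assms]
  show ?case
  proof (intro allI impI ballI conjI)
    fix \<gamma> \<tau> :: real and \<mu> :: "'d torus measure"
    assume *: "0 < \<gamma>" "0 < \<tau>" "\<mu> \<in> Prob" "mixing_DC N \<gamma> \<tau> \<mu>"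
    \<comment> \<open>Any admissible loss gives a positive exponent; take half of \<open>\<alpha> / \<tau>\<close>.\<close>
    then have "0 < \<alpha> / (2 * \<tau>)" "\<alpha> / (2 * \<tau>) < \<alpha> / \<tau>" "0 < \<alpha> / \<tau> - \<alpha> / (2 * \<tau>)"
      using assms by (auto simp: field_simps)
    with rate[OF *] show "\<exists>C p. p > 0 \<and> mixing_power_rate \<mu> \<alpha> C p" by blast
    fix \<iota> assume "0 < \<iota> \<and> \<iota> < \<alpha> / \<tau>"
    with rate[OF *] show "\<exists>C. mixing_power_rate \<mu> \<alpha> C (\<alpha> / \<tau> - \<iota>)" by blast
  qed
next
  case 2
  \<comment> \<open>The rate must be a function of the four parameters alone, so the mixing time is selected by a choice that quantifies over all admissible \<open>\<mu>\<close> and \<open>\<phi>\<close>.\<close>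
  define good where "good \<epsilon> L \<gamma> \<tau> m \<longleftrightarrow> (\<forall>\<mu>\<in>(Prob :: 'd torus measure set). mixing_DC N \<gamma> \<tau> \<mu> \<longrightarrow>
    (\<forall>\<phi>\<in>holder_space \<alpha>. holder_norm \<alpha> \<phi> = L \<longrightarrow>
      (\<forall>\<theta>. \<bar>(markov \<mu> ^^ m) \<phi> \<theta> - (\<integral>y. \<phi> y \<partial>haar)\<bar> \<le> \<epsilon> / 4)))" for \<epsilon> L \<gamma> \<tau> m
  define m where "m \<epsilon> L \<gamma> \<tau> = (SOME m. good \<epsilon> L \<gamma> \<tau> m)" for \<epsilon> L \<gamma> \<tau>
  have m: "good \<epsilon> L \<gamma> \<tau> (m \<epsilon> L \<gamma> \<tau>)" if "0 < \<gamma>" "0 < \<tau>" "0 < \<epsilon>" for \<epsilon> L \<gamma> \<tau>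
    unfolding m_def by (rule someI_ex) (use uniform_mixing_time[OF assms that(1,2), of "\<epsilon> / 4"] that(3) in \<open>simp add: good_def\<close>)
  \<comment> \<open>Half of the rate in \<open>birkhoff_deviation\<close>; the other half absorbs the factor \<open>2\<close> once \<open>c n \<ge> 2\<close>.\<close>
  define c where "c \<epsilon> L \<gamma> \<tau> = \<epsilon>\<^sup>2 / (64 * (real (m \<epsilon> L \<gamma> \<tau>) * L + 1)\<^sup>2)" for \<epsilon> L \<gamma> \<tau>
  define n\<^sub>0 where "n\<^sub>0 \<epsilon> L \<gamma> \<tau> = nat \<lceil>1 + 4 * ((2 * real (m \<epsilon> L \<gamma> \<tau>) + 1) * L) / \<epsilon> + 2 / c \<epsilon> L \<gamma> \<tau>\<rceil>" for \<epsilon> L \<gamma> \<tau>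
  show ?case
  proof (rule exI[of _ c], rule exI[of _ n\<^sub>0], intro allI impI ballI)
    fix \<gamma> \<tau> \<epsilon> :: real and \<mu> :: "'d torus measure" and \<phi> :: "'d torus \<Rightarrow> real"
    assume *: "0 < \<gamma>" "0 < \<tau>" "\<mu> \<in> Prob" "mixing_DC N \<gamma> \<tau> \<mu>" "\<phi> \<in> holder_space \<alpha>" "0 < \<epsilon>"
    interpret prob_space \<mu> using *(3) by (simp add: Prob_def)
    interpret torus_walk \<mu> by unfold_locales (use *(3) in \<open>simp add: Prob_def\<close>)
    let ?L = "holder_norm \<alpha> \<phi>"
    let ?m = "m \<epsilon> ?L \<gamma> \<tau>" and ?c = "c \<epsilon> ?L \<gamma> \<tau>" and ?n = "n\<^sub>0 \<epsilon> ?L \<gamma> \<tau>"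
    note h = holder_space_bounds[OF *(5) assms(2)]
    have L0: "0 \<le> ?L" using h(2)[of 0] by linarith
    have near: "\<bar>(markov \<mu> ^^ ?m) \<phi> \<theta> - (\<integral>y. \<phi> y \<partial>haar)\<bar> \<le> \<epsilon> / 4" for \<theta>
      using m[OF *(1,2,6)] * by (simp add: good_def)
    have int: "\<bar>\<integral>y. \<phi> y \<partial>haar\<bar> \<le> ?L"
    proof -
      have "integrable haar \<phi>" using h(1,2) by (intro haar.integrable_const_bound[of _ ?L]) auto
      from haar.norm_expectation_le[OF this, of ?L] h(2) show ?thesis by simp
    qed
    have A: "0 < real ?m * ?L + 1" using L0 by (simp add: add_nonneg_pos)
    have c: "0 < ?c" using *(6) A by (simp add: c_def)
    have "\<P>(\<omega> in (\<Pi>\<^sub>M i\<in>(UNIV :: nat set). \<mu>).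
                   \<bar>(1 / real n) * (\<Sum>j=0..n. \<phi> (\<theta> + (\<Sum>i<j. \<omega> i))) - (\<integral>\<theta>'. \<phi> \<theta>' \<partial>haar)\<bar> > \<epsilon>)
                < exp (- ?c * real n)" if n: "n \<ge> ?n" for n \<theta>
    proof -
      let ?T = "4 * ((2 * real ?m + 1) * ?L) / \<epsilon>"
      have "0 \<le> ?T" "0 < 2 / ?c" using L0 c *(6) by auto
      moreover have "1 + ?T + 2 / ?c \<le> real n"
        using n unfolding n\<^sub>0_def by linarith
      ultimately have n1: "1 \<le> real n" "?T \<le> real n" "2 / ?c \<le> real n" by linarith+
      have n2: "(2 * real ?m + 1) * ?L \<le> real n * (\<epsilon> / 4)"
        using n1(2) *(6) by (simp add: field_simps)
      have "2 \<le> ?c * real n" using n1(3) c by (simp add: field_simps)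
      then have two: "2 < exp (?c * real n)"
        using exp_ge_add_one_self[of "?c * real n"] by linarith
      have "\<P>(\<omega> in (\<Pi>\<^sub>M i\<in>(UNIV :: nat set). \<mu>).
                   \<bar>(1 / real n) * (\<Sum>j=0..n. \<phi> (\<theta> + (\<Sum>i<j. \<omega> i))) - (\<integral>\<theta>'. \<phi> \<theta>' \<partial>haar)\<bar> > \<epsilon>)
          \<le> 2 * exp (- (\<epsilon>\<^sup>2 / (32 * (real ?m * ?L + 1)\<^sup>2)) * real n)"
        using n1(1) by (intro birkhoff_deviation h(1,2) near int *(6) n2) auto
      also have "- (\<epsilon>\<^sup>2 / (32 * (real ?m * ?L + 1)\<^sup>2)) * real n = - ?c * real n + - ?c * real n"
        by (simp add: c_def field_simps)
      also have "2 * exp (- ?c * real n + - ?c * real n) = (2 * exp (- ?c * real n)) * exp (- ?c * real n)"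
        by (simp only: exp_add mult.assoc)
      also have "\<dots> < 1 * exp (- ?c * real n)"
        using two by (intro mult_strict_right_mono) (simp_all add: exp_minus field_simps)
      finally show ?thesis by simp
    qed
    with c show "?c > 0 \<and> (\<forall>n\<ge>?n. \<forall>\<theta>.
                \<P>(\<omega> in (\<Pi>\<^sub>M i\<in>(UNIV :: nat set). \<mu>).
                   \<bar>(1 / real n) * (\<Sum>j=0..n. \<phi> (\<theta> + (\<Sum>i<j. \<omega> i))) - (\<integral>\<theta>'. \<phi> \<theta>' \<partial>haar)\<bar> > \<epsilon>)
                < exp (- ?c * real n))" by blast
  qed
qed

end
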